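(* Let $L_{bc}$ be the Hill operator $Ly=-y''+v(x)y$ on $[0,\pi]$ with potential $v=v_0+Q'$ as described in the context, and let $bc$ be one of $Per^+$, $Per^-$, $Dir$. Let $P_n$ be the Riesz projection of $L_{bc}$ and $P_n^0$ that of the free operator $L^0_{bc}$ associated with the circle $C_n=\{z\in\mathbb{C}:|z-n^2|=n\}$. Then $$\|P_n-P_n^0\|_{L^1([0,\pi])\to L^\infty([0,\pi])}\to 0\quad\text{as } n\to\infty.$$
   Context: Let $v_0\in\mathbb{C}$ and $Q\in L^2_{loc}(\mathbb{R})$ be $\pi$-periodic with $\int_0^\pi Q(x)\,dx=0$; set $v=v_0+Q'$ (a $\pi$-periodic distribution in $H^{-1}_{loc}(\mathbb{R})$). For a function $y$ on $[0,\pi]$ its quasi-derivative is $u=y'-Qy$. The operator $L_{bc}$ acts by $\ell(y)=-u'-Qu-Q^2y+v_0y$ (which equals $-y''+vy$ formally) on the domain of those $y$ with $y$ and $u$ absolutely continuous on $[0,\pi]$, $\ell(y)\in L^2([0,\pi])$, and satisfying the boundary conditions: $Per^\pm$: $y(\pi)=\pm y(0)$, $u(\pi)=\pm u(0)$; $Dir$: $y(0)=y(\pi)=0$. The free operator $L^0_{bc}$ is the same operator with $v=0$ (i.e. $-y''$ with the same boundary conditions). For all sufficiently large $n$ the circle $C_n=\{|z-n^2|=n\}$ lies in the resolvent sets of $L_{bc}$ and $L^0_{bc}$, and $P_n=\frac{1}{2\pi i}\int_{C_n}(z-L_{bc})^{-1}dz$, $P_n^0=\frac{1}{2\pi i}\int_{C_n}(z-L^0_{bc})^{-1}dz$.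 (For $Per^+$ the relevant $n$ are even, for $Per^-$ odd, for $Dir$ all $n\in\mathbb{N}$.) *)

theory Defs
  imports "HOL-Complex_Analysis.Complex_Analysis"
begin

datatype bc = PerPlus | PerMinus | Dir

definition L2_on :: "(real \<Rightarrow> complex) \<Rightarrow> bool" where
  "L2_on f \<longleftrightarrow> f measurable_on {0..pi} \<and> (\<lambda>x. (cmod (f x))^2) integrable_on {0..pi}"

definition L1_norm :: "(real \<Rightarrow> complex) \<Rightarrow> real" where
  "L1_norm f = integral {0..pi} (\<lambda>x. cmod (f x))"

text \<open>Boundary conditions on y and its quasi-derivative u.\<close>
fun bc_holds :: "bc \<Rightarrow> (real \<Rightarrow> complex) \<Rightarrow> (real \<Rightarrow> complex) \<Rightarrow> bool" where
  "bc_holds PerPlus y u \<longleftrightarrow> y pi = y 0 \<and> u pi = u 0"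
| "bc_holds PerMinus y u \<longleftrightarrow> y pi = - y 0 \<and> u pi = - u 0"
| "bc_holds Dir y u \<longleftrightarrow> y 0 = 0 \<and> y pi = 0"

text \<open>y (extended by 0 outside [0,pi]) lies in the domain of L_bc, with quasi-derivative u
  (u = y' - Q y) and l the value of the differential expression l(y) = -u' - Q u - Q^2 y + v0 y.
  Absolute continuity of y and u is expressed as being indefinite Lebesgue integrals.\<close>
definition in_dom :: "(real \<Rightarrow> complex) \<Rightarrow> complex \<Rightarrow> bc \<Rightarrow> (real \<Rightarrow> complex)
    \<Rightarrow> (real \<Rightarrow> complex) \<Rightarrow> bool" where
  "in_dom Q v0 b y l \<longleftrightarrow>
     (\<forall>x. x \<notin> {0..pi} \<longrightarrow> y x = 0) \<and>
     (\<exists>u g.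
        (\<lambda>t. Q t * y t + u t) absolutely_integrable_on {0..pi} \<and>
        (\<forall>x\<in>{0..pi}. y x = y 0 + integral {0..x} (\<lambda>t. Q t * y t + u t)) \<and>
        g absolutely_integrable_on {0..pi} \<and>
        (\<forall>x\<in>{0..pi}. u x = u 0 + integral {0..x} g) \<and>
        (\<exists>N. negligible N \<and>
           (\<forall>x\<in>{0..pi} - N. l x = - g x - Q x * u x - (Q x)^2 * y x + v0 * y x)) \<and>
        L2_on l \<and>
        bc_holds b y u)"

definition solves :: "(real \<Rightarrow> complex) \<Rightarrow> complex \<Rightarrow> bc \<Rightarrow> complex \<Rightarrow> (real \<Rightarrow> complex)
    \<Rightarrow> (real \<Rightarrow> complex) \<Rightarrow> bool" where
  "solves Q v0 b z f y \<longleftrightarrow>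
     (\<exists>l. in_dom Q v0 b y l \<and>
        (\<exists>N. negligible N \<and> (\<forall>x\<in>{0..pi} - N. z * y x - l x = f x)))"

text \<open>Resolvent (z - L_bc)^{-1} f (meaningful for z in the resolvent set).\<close>
definition resolvent :: "(real \<Rightarrow> complex) \<Rightarrow> complex \<Rightarrow> bc \<Rightarrow> complex \<Rightarrow> (real \<Rightarrow> complex)
    \<Rightarrow> real \<Rightarrow> complex" where
  "resolvent Q v0 b z f = (THE y. solves Q v0 b z f y)"

definition riesz_proj :: "(real \<Rightarrow> complex) \<Rightarrow> complex \<Rightarrow> bc \<Rightarrow> nat \<Rightarrow> (real \<Rightarrow> complex)
    \<Rightarrow> real \<Rightarrow> complex" where
  "riesz_proj Q v0 b n f x =
     contour_integral (circlepath (of_nat n ^ 2) (real n)) (\<lambda>z. resolvent Q v0 b z f x)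
       / (2 * of_real pi * \<i>)"

fun relevant_index :: "bc \<Rightarrow> nat \<Rightarrow> bool" where
  "relevant_index PerPlus n \<longleftrightarrow> even n"
| "relevant_index PerMinus n \<longleftrightarrow> odd n"
| "relevant_index Dir n \<longleftrightarrow> n \<ge> 1"

end

theory Submission
  imports Defs
begin

text \<open>On the circle \<open>C\<^sub>n\<close> write \<open>z = k\<^sup>2\<close>; then \<open>1/3 \<le> \<bar>k - n\<bar> \<le> 2/3\<close>, so \<open>Im k\<close> is bounded and
  \<open>exp (2\<pi>ik)\<close> stays away from 1. In the coordinates \<open>exp (\<plusminus>ikx) (y \<plusminus> i u / k)\<close> the equation
  \<open>(z - L) y = f\<close> becomes a first-order system \<open>w' = A w + F\<close> with \<open>F = O(f / n)\<close>, where by the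
  Riemann-Lebesgue lemma the primitive of \<open>A\<close> tends to 0 uniformly as \<open>n \<rightarrow> \<infinity>\<close>. Integrating \<open>A w\<close> by
  parts shows that the solution differs from the one with \<open>A = 0\<close>, which does not depend on the
  potential, by \<open>o(1/n)\<close> times the \<open>L\<^sup>1\<close> norm of \<open>f\<close>, uniformly on \<open>C\<^sub>n\<close>. The two resolvents therefore
  differ by \<open>o(1/n)\<close>, and \<open>C\<^sub>n\<close> has length \<open>2\<pi>n\<close>.\<close>

subsection \<open>Integrable functions on \<open>[0,\<pi>]\<close>\<close>

text \<open>As \<open>Q\<close> is only square integrable, the off-diagonal entries of
  \<open>A\<close> are not small in \<open>L1\<close>, and a one-step perturbation argument in the
  sup norm fails. Every gain comes from primitives, at the price of a bound on \<open>w'\<close>,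
  which the equation itself supplies. The radius \<open>n\<close> is the natural scale:
  \<open>z - n^2\<close> is about \<open>2n (k - n)\<close>, so on the circle \<open>k - n\<close>
  has modulus about 1/2, well away from the integers, where \<open>exp (2\<pi>ik) = 1\<close>. The
  boundary conditions enter only through a matrix that expresses the initial amplitudes by their
  increments over \<open>[0,pi]\<close>; a bounded matrix is all that the analysis needs, so one
  argument covers the three cases. Estimates alone do not suffice: \<open>resolvent\<close> is a
  definite description and a contour integral has a default value, so existence and uniqueness of
  the solution, and its continuity in \<open>z\<close> along \<open>C\<^sub>n\<close>, have to be
  established too.\<close>

abbreviation AI :: "(real \<Rightarrow> complex) \<Rightarrow> bool" where
  "AI f \<equiv> f absolutely_integrable_on {0..pi}"

lemma AI_norm_integrable: "AI f \<Longrightarrow> (\<lambda>x. cmod (f x)) integrable_on {0..pi}"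
  by (simp add: absolutely_integrable_on_def)

lemma AI_integrable: "AI f \<Longrightarrow> f integrable_on {0..pi}"
  by (simp add: absolutely_integrable_on_def)

lemma AI_subset: "AI f \<Longrightarrow> 0 \<le> s \<Longrightarrow> t \<le> pi \<Longrightarrow> f absolutely_integrable_on {s..t}"
  by (rule absolutely_integrable_on_subinterval) auto

lemma AI_mult:
  assumes "h \<in> borel_measurable (lebesgue_on {0..pi})" "\<And>x. x \<in> {0..pi} \<Longrightarrow> cmod (h x) \<le> M" "AI f"
  shows "AI (\<lambda>x. h x * f x)"
proof -
  have "bounded (h ` {0..pi})"
    unfolding bounded_iff by (intro exI[of _ M]) (use assms(2) in auto)
  then show ?thesis
    by (intro absolutely_integrable_bounded_measurable_product[OF bilinear_times assms(1)])
       (use assms in auto)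
qed

lemma AI_mult_continuous:
  assumes "continuous_on {0..pi} h" "AI f"
  shows "AI (\<lambda>x. h x * f x)"
proof -
  have "compact (h ` {0..pi})" using assms(1) by (intro compact_continuous_image) auto
  then obtain M where "\<And>x. x \<in> {0..pi} \<Longrightarrow> cmod (h x) \<le> M"
    by (meson bounded_iff compact_imp_bounded imageI)
  with assms show ?thesis
    by (intro AI_mult continuous_imp_measurable_on_sets_lebesgue) auto
qed

lemma AI_continuous: "continuous_on {0..pi} h \<Longrightarrow> AI h"
  by (rule absolutely_integrable_continuous_real)

text \<open>No integrability is assumed, because the integral of a non-integrable function is 0 by
  convention.\<close>

lemma L1_norm_nonneg [simp]: "0 \<le> L1_norm f"
proof (cases "(\<lambda>x. cmod (f x)) integrable_on {0..pi}")
  case True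
  then show ?thesis by (simp add: L1_norm_def Henstock_Kurzweil_Integration.integral_nonneg)
qed (simp add: L1_norm_def not_integrable_integral)

lemma norm_integral_le_L1_norm:
  assumes "AI f" "0 \<le> s" "t \<le> pi"
  shows "cmod (integral {s..t} f) \<le> L1_norm f"
proof -
  have i: "f absolutely_integrable_on {s..t}" by (rule AI_subset[OF assms])
  have "cmod (integral {s..t} f) \<le> integral {s..t} (\<lambda>x. cmod (f x))"
    using i by (auto simp: absolutely_integrable_on_def intro!: integral_norm_bound_integral)
  also have "\<dots> \<le> integral {0..pi} (\<lambda>x. cmod (f x))"
    by (rule integral_subset_le) (use assms i in \<open>auto simp: absolutely_integrable_on_def\<close>)
  finally show ?thesis by (simp add: L1_norm_def)
qed

lemma L1_norm_mult_le:
  assumes "AI f" "AI (\<lambda>x. h x * f x)" "\<And>x. x \<in> {0..pi} \<Longrightarrow> cmod (h x) \<le> M"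
  shows "L1_norm (\<lambda>x. h x * f x) \<le> M * L1_norm f"
proof -
  have "L1_norm (\<lambda>x. h x * f x) \<le> integral {0..pi} (\<lambda>x. M * cmod (f x))"
    unfolding L1_norm_def using assms
    by (intro integral_le AI_norm_integrable integrable_on_mult_right)
       (auto simp: norm_mult intro!: mult_right_mono)
  then show ?thesis by (simp add: L1_norm_def)
qed

lemma L1_norm_sum_le:
  assumes "finite J" "\<And>j. j \<in> J \<Longrightarrow> AI (f j)"
  shows "L1_norm (\<lambda>x. \<Sum>j\<in>J. f j x) \<le> (\<Sum>j\<in>J. L1_norm (f j))"
proof -
  have "L1_norm (\<lambda>x. \<Sum>j\<in>J. f j x) \<le> integral {0..pi} (\<lambda>x. \<Sum>j\<in>J. cmod (f j x))"
    unfolding L1_norm_def using assms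
    by (intro integral_le AI_norm_integrable absolutely_integrable_sum integrable_sum norm_sum) auto
  also have "\<dots> = (\<Sum>j\<in>J. L1_norm (f j))"
    unfolding L1_norm_def using assms AI_norm_integrable by (intro integral_sum) auto
  finally show ?thesis .
qed

lemma L1_norm_add_le:
  assumes "AI f" "AI g"
  shows "L1_norm (\<lambda>x. f x + g x) \<le> L1_norm f + L1_norm g"
  using L1_norm_sum_le[of "UNIV :: bool set" "\<lambda>b. if b then f else g"] assms
  by (simp add: UNIV_bool add.commute)

lemma L1_norm_diff_le:
  assumes "AI f" "AI g"
  shows "L1_norm (\<lambda>x. f x - g x) \<le> L1_norm f + L1_norm g"
  using L1_norm_add_le[OF assms(1), of "\<lambda>x. - g x"] AI_mult_continuous[OF continuous_on_const assms(2), of "-1"]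
  by (simp add: L1_norm_def)

section \<open>Density of polynomials in \<open>L1\<close>\<close>

lemma AI_measurable: "AI f \<Longrightarrow> f \<in> borel_measurable (lebesgue_on {0..pi})"
  using integrable_imp_measurable AI_integrable by blast

text \<open>Truncation: the error is dominated by \<open>cmod (f x)\<close> and is eventually 0 at
  each point, so dominated convergence applies.\<close>

lemma L1_approx_bounded:
  assumes f: "AI f" and e: "e > 0"
  obtains g M where "AI g" "\<And>x. cmod (g x) \<le> M" "M > 0" "L1_norm (\<lambda>x. f x - g x) < e"
proof -
  \<comment> \<open>Radial projection onto the disc of radius \<open>M\<close>, the identity on that
    disc; dividing by the maximum makes it continuous everywhere.\<close>
  define c where "c M w = (M / max M (cmod w)) *\<^sub>R w" for M :: real and w
  have nc: "cmod (c M w) \<le> M \<and> cmod (w - c M w) \<le> cmod w" if "M > 0" for M w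
  proof 
    show "cmod (c M w) \<le> M" using that by (auto simp: c_def max_def field_simps)
    have "w - c M w = (1 - M / max M (cmod w)) *\<^sub>R w" by (simp add: c_def algebra_simps)
    moreover have "\<bar>1 - M / max M (cmod w)\<bar> \<le> 1" using that
      by (auto simp: max_def abs_le_iff divide_simps)
    ultimately show "cmod (w - c M w) \<le> cmod w"
      using mult_right_mono[of "\<bar>1 - M / max M (cmod w)\<bar>" 1 "cmod w"] by simp
  qed
  have cc: "continuous_on UNIV (c M)" if "M > 0" for M
    unfolding c_def by (intro continuous_intros) (use that in auto)
  have AIc: "AI (\<lambda>x. c (real (Suc n)) (f x))" for n
  proof (rule measurable_bounded_by_integrable_imp_absolutely_integrable)
    show "(\<lambda>x. c (real (Suc n)) (f x)) \<in> borel_measurable (lebesgue_on {0..pi})"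
      by (rule borel_measurable_continuous_on[OF cc AI_measurable[OF f]]) simp
    show "(\<lambda>x. real (Suc n)) integrable_on {0..pi}" by (intro integrable_const_ivl)
  qed (use nc[of "real (Suc n)"] in auto)
  have "(\<lambda>n. integral {0..pi} (\<lambda>x. cmod (f x - c (real (Suc n)) (f x)))) \<longlonglongrightarrow> integral {0..pi} (\<lambda>x. 0)"
  proof (rule dominated_convergence(2))
    show "(\<lambda>x. cmod (f x - c (real (Suc n)) (f x))) integrable_on {0..pi}" for n
      by (intro AI_norm_integrable set_integral_diff f AIc)
    show "(\<lambda>x. cmod (f x)) integrable_on {0..pi}" by (rule AI_norm_integrable[OF f])
    show "norm (cmod (f x - c (real (Suc n)) (f x))) \<le> cmod (f x)" for n x
      using nc[of "real (Suc n)"] by auto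
    show "(\<lambda>n. cmod (f x - c (real (Suc n)) (f x))) \<longlonglongrightarrow> 0" for x
    proof (rule tendsto_eventually)
      obtain n0 :: nat where "cmod (f x) \<le> real n0" using real_arch_simple by blast
      then show "\<forall>\<^sub>F n in sequentially. cmod (f x - c (real (Suc n)) (f x)) = 0"
        by (intro eventually_sequentiallyI[of n0]) (auto simp: c_def max_def)
    qed
  qed
  then have "(\<lambda>n. L1_norm (\<lambda>x. f x - c (real (Suc n)) (f x))) \<longlonglongrightarrow> 0" by (simp add: L1_norm_def)
  from order_tendstoD(2)[OF this e] obtain n where "L1_norm (\<lambda>x. f x - c (real (Suc n)) (f x)) < e"
    by (auto simp: eventually_sequentially)
  with AIc nc show ?thesis by (intro that[of "\<lambda>x. c (real (Suc n)) (f x)" "real (Suc n)"]) auto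
qed

text \<open>A measurable function is an almost everywhere limit of continuous ones. Projecting these
  onto the disc of radius \<open>M\<close> does not disturb the limit, as \<open>g\<close> takes its
  values there, and supplies the constant majorant \<open>2 * M\<close>.\<close>

lemma L1_approx_bounded_continuous:
  assumes g: "AI g" "\<And>x. cmod (g x) \<le> M" "M > 0" and e: "e > 0"
  obtains h where "continuous_on {0..pi} h" "L1_norm (\<lambda>x. g x - h x) < e"
proof -
  define c where "c w = (M / max M (cmod w)) *\<^sub>R w" for w
  have nc: "cmod (c w) \<le> M" for w using \<open>M > 0\<close> by (auto simp: c_def max_def field_simps)
  have cc: "continuous_on UNIV c"
    unfolding c_def by (intro continuous_intros) (use \<open>M > 0\<close> in auto)
  have "g measurable_on {0..pi}"
    using AI_measurable[OF g(1)] by (simp add: measurable_on_iff_borel_measurable)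
  then obtain N h where N: "negligible N" and h: "\<And>n. continuous_on UNIV (h n)"
    and lim: "\<And>x. x \<notin> N \<Longrightarrow> (\<lambda>n. h n x) \<longlonglongrightarrow> (if x \<in> {0..pi} then g x else 0)"
    unfolding measurable_on_def by blast
  define k where "k n x = c (h n x)" for n x
  have kc: "continuous_on {0..pi} (k n)" for n
    unfolding k_def by (rule continuous_on_compose2[OF cc continuous_on_subset[OF h]]) auto
  have klim: "(\<lambda>n. k n x) \<longlonglongrightarrow> g x" if "x \<in> {0..pi} - N" for x
  proof -
    have "isCont c (g x)" using cc by (simp add: continuous_on_eq_continuous_at)
    moreover have "(\<lambda>n. h n x) \<longlonglongrightarrow> g x" using lim[of x] that by simp
    ultimately have "(\<lambda>n. c (h n x)) \<longlonglongrightarrow> c (g x)"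
      by (rule isCont_tendsto_compose)
    moreover have "c (g x) = g x" using g(2)[of x] \<open>M > 0\<close> by (auto simp: c_def max_def)
    ultimately show ?thesis by (simp add: k_def)
  qed
  \<comment> \<open>Setting the difference to 0 on the exceptional set \<open>N\<close> makes the
    convergence hold at every point.\<close>
  have gN: "AI (\<lambda>x. if x \<in> N then 0 else g x - k n x)" for n
    by (rule absolutely_integrable_spike[OF _ N])
       (use set_integral_diff(1)[OF g(1) AI_continuous[OF kc[of n]]] in \<open>auto\<close>)
  have "(\<lambda>n. integral {0..pi} (\<lambda>x. cmod (if x \<in> N then 0 else g x - k n x))) \<longlonglongrightarrow> integral {0..pi} (\<lambda>x. 0)"
  proof (rule dominated_convergence(2))
    show "(\<lambda>x. cmod (if x \<in> N then 0 else g x - k n x)) integrable_on {0..pi}" for n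
      by (intro AI_norm_integrable gN)
    show "(\<lambda>x. 2 * M) integrable_on {0..pi}" by (intro integrable_const_ivl)
    show "norm (cmod (if x \<in> N then 0 else g x - k n x)) \<le> 2 * M" for n x
      using g(2)[of x] nc[of "h n x"] norm_triangle_ineq4[of "g x" "k n x"] \<open>M > 0\<close>
      by (auto simp: k_def)
    show "(\<lambda>n. cmod (if x \<in> N then 0 else g x - k n x)) \<longlonglongrightarrow> 0" if "x \<in> {0..pi}" for x
    proof (cases "x \<in> N")
      case False
      with klim[of x] that have "(\<lambda>n. k n x) \<longlonglongrightarrow> g x" by blast
      from tendsto_norm_zero[OF LIM_zero[OF this]] False show ?thesis by (simp add: norm_minus_commute)
    qed simp
  qed
  moreover have "integral {0..pi} (\<lambda>x. cmod (if x \<in> N then 0 else g x - k n x)) = L1_norm (\<lambda>x. g x - k n x)" for n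
    unfolding L1_norm_def by (rule integral_spike[OF N]) auto
  ultimately have "(\<lambda>n. L1_norm (\<lambda>x. g x - k n x)) \<longlonglongrightarrow> 0" by simp
  from order_tendstoD(2)[OF this e] obtain n where "L1_norm (\<lambda>x. g x - k n x) < e"
    by (auto simp: eventually_sequentially)
  with kc that show ?thesis by blast
qed

text \<open>Truncation, then a continuous approximant, then Stone-Weierstrass. Polynomials are
  wanted because the Riemann-Lebesgue argument differentiates the approximant.\<close>

lemma L1_approx_polynomial:
  assumes f: "AI f" and e: "e > 0"
  obtains p where "polynomial_function p" "L1_norm (\<lambda>x. f x - p x) < e"
proof -
  obtain g M where g: "AI g" "\<And>x. cmod (g x) \<le> M" "M > 0" "L1_norm (\<lambda>x. f x - g x) < e/3"
    using L1_approx_bounded[OF f, of "e/3"] e by auto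
  obtain h where h: "continuous_on {0..pi} h" "L1_norm (\<lambda>x. g x - h x) < e/3"
    using L1_approx_bounded_continuous[OF g(1-3), of "e/3"] e by auto
  \<comment> \<open>Integrated over length \<open>pi\<close> this tolerance gives
    \<open>e / 4\<close>, less than the remaining third.\<close>
  obtain p where p: "polynomial_function p" "\<And>x. x \<in> {0..pi} \<Longrightarrow> cmod (h x - p x) < e / (4 * pi)"
    using Stone_Weierstrass_polynomial_function[OF compact_Icc h(1), of "e/(4*pi)"] e by auto
  have AIp: "AI p" using p(1) by (intro AI_continuous continuous_on_polymonial_function)
  have "L1_norm (\<lambda>x. h x - p x) \<le> integral {0..pi} (\<lambda>x. e / (4 * pi))"
    unfolding L1_norm_def using p(2) AIp h(1)
    by (intro integral_le AI_norm_integrable set_integral_diff AI_continuous[OF h(1)] AIp) (auto simp: less_imp_le)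
  then have 3: "L1_norm (\<lambda>x. h x - p x) < e/3" using e by simp
  have "L1_norm (\<lambda>x. f x - p x) = L1_norm (\<lambda>x. (f x - g x) + ((g x - h x) + (h x - p x)))" by simp
  also have "\<dots> \<le> L1_norm (\<lambda>x. f x - g x) + (L1_norm (\<lambda>x. g x - h x) + L1_norm (\<lambda>x. h x - p x))"
    using f g(1) AI_continuous[OF h(1)] AIp
    by (intro order_trans[OF L1_norm_add_le] add_mono L1_norm_add_le set_integral_diff set_integral_add order_refl)
  finally show ?thesis using that[OF p(1)] 3 g(4) h(2) by simp
qed

subsection \<open>Absolutely continuous functions\<close>

text \<open>\<open>AC F f\<close>: \<open>F\<close> is absolutely continuous on \<open>[0,\<pi>]\<close> with derivative \<open>f\<close>.\<close>

definition AC :: "(real \<Rightarrow> complex) \<Rightarrow> (real \<Rightarrow> complex) \<Rightarrow> bool" where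
  "AC F f \<longleftrightarrow> AI f \<and> (\<forall>x\<in>{0..pi}. F x = F 0 + integral {0..x} f)"

lemma AC_AI: "AC F f \<Longrightarrow> AI f"
  by (simp add: AC_def)

lemma AC_eq: "AC F f \<Longrightarrow> x \<in> {0..pi} \<Longrightarrow> F x = F 0 + integral {0..x} f"
  unfolding AC_def by blast

lemma AC_integral: "AC F f \<Longrightarrow> x \<in> {0..pi} \<Longrightarrow> integral {0..x} f = F x - F 0"
  using AC_eq[of F f x] by (simp add: algebra_simps)

lemma AI_integrable_subset: "AI f \<Longrightarrow> x \<le> pi \<Longrightarrow> f integrable_on {0..x}"
  using AI_subset[of f 0 x] by (simp add: absolutely_integrable_on_def)

lemma continuous_on_indefinite: "AI f \<Longrightarrow> continuous_on {0..pi} (\<lambda>x. integral {0..x} f)"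
  by (intro indefinite_integral_continuous_1 AI_integrable)

lemma AC_continuous:
  assumes "AC F f"
  shows "continuous_on {0..pi} F"
proof -
  have "continuous_on {0..pi} (\<lambda>x. F 0 + integral {0..x} f)"
    by (intro continuous_intros continuous_on_indefinite AC_AI[OF assms])
  then show ?thesis
    by (rule continuous_on_eq) (simp add: AC_integral[OF assms])
qed

lemma AC_indefinite: "AI f \<Longrightarrow> AC (\<lambda>x. c + integral {0..x} f) f"
  by (simp add: AC_def)

text \<open>This absorbs the null sets in \<open>in_dom\<close> and \<open>solves\<close>. As the
  function itself only matters on \<open>[0,pi]\<close>, it also allows solutions to be extended by
  0.\<close>

lemma AC_cong:
  assumes "AC F f" "negligible N"
    and "\<And>x. x \<in> {0..pi} \<Longrightarrow> G x = F x" "\<And>x. x \<in> {0..pi} - N \<Longrightarrow> g x = f x"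
  shows "AC G g"
  unfolding AC_def
proof (intro conjI ballI)
  show "AI g" by (rule absolutely_integrable_spike[OF AC_AI[OF assms(1)] assms(2,4)])
  fix x assume x: "x \<in> {0..pi}"
  have "integral {0..x} g = integral {0..x} f"
    by (rule integral_spike[OF assms(2)]) (use x assms(4) in auto)
  then show "G x = G 0 + integral {0..x} g"
    using AC_eq[OF assms(1) x] assms(3)[OF x] assms(3)[of 0] by simp
qed

lemma AC_mult_const:
  assumes "AC F f"
  shows "AC (\<lambda>x. c * F x) (\<lambda>x. c * f x)"
  unfolding AC_def
proof (intro conjI ballI)
  show "AI (\<lambda>x. c * f x)" by (rule AI_mult_continuous[OF continuous_on_const AC_AI[OF assms]])
qed (simp add: AC_integral[OF assms] algebra_simps)

lemma AC_add:
  assumes "AC F f" "AC G g"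
  shows "AC (\<lambda>x. F x + G x) (\<lambda>x. f x + g x)"
  unfolding AC_def
proof (intro conjI ballI)
  show "AI (\<lambda>x. f x + g x)" by (intro set_integral_add AC_AI[OF assms(1)] AC_AI[OF assms(2)])
  fix x assume x: "x \<in> {0..pi}"
  have "integral {0..x} (\<lambda>x. f x + g x) = integral {0..x} f + integral {0..x} g"
    using x by (intro Henstock_Kurzweil_Integration.integral_add AI_integrable_subset
        AC_AI[OF assms(1)] AC_AI[OF assms(2)]) auto
  then show "F x + G x = F 0 + G 0 + integral {0..x} (\<lambda>x. f x + g x)"
    using x by (simp add: AC_integral[OF assms(1)] AC_integral[OF assms(2)])
qed

lemma AC_diff:
  assumes "AC F f" "AC G g"
  shows "AC (\<lambda>x. F x - G x) (\<lambda>x. f x - g x)"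
  using AC_add[OF assms(1) AC_mult_const[OF assms(2), of "-1"]] by simp

lemma AC_C1:
  assumes "\<And>x. (F has_vector_derivative f x) (at x)" "continuous_on {0..pi} f"
  shows "AC F f"
  unfolding AC_def
proof (intro conjI ballI)
  show "AI f" by (rule AI_continuous[OF assms(2)])
  fix x assume "x \<in> {0..pi}"
  then have "(f has_integral F x - F 0) {0..x}"
    by (intro fundamental_theorem_of_calculus) (auto intro: has_vector_derivative_at_within assms(1))
  then show "F x = F 0 + integral {0..x} f" by (simp add: integral_unique)
qed

text \<open>The error in integration by parts is bounded by a multiple of \<open>L1_norm f * L1_norm g\<close>, so it
  vanishes once it does for a dense class of \<open>f\<close> and \<open>g\<close>; this avoids Fubini.\<close>

definition parts_defect :: "real \<Rightarrow> (real \<Rightarrow> complex) \<Rightarrow> (real \<Rightarrow> complex) \<Rightarrow> complex" where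
  "parts_defect x f g = integral {0..x} f * integral {0..x} g
     - integral {0..x} (\<lambda>t. f t * integral {0..t} g + integral {0..t} f * g t)"

lemma AI_parts:
  assumes "AI f" "AI g"
  shows "AI (\<lambda>t. f t * integral {0..t} g)" "AI (\<lambda>t. integral {0..t} f * g t)"
  using AI_mult_continuous[OF continuous_on_indefinite[OF assms(1)] assms(2)]
    AI_mult_continuous[OF continuous_on_indefinite[OF assms(2)] assms(1)] by (simp_all add: mult.commute)

lemma parts_defect_commute: "parts_defect x f g = parts_defect x g f"
  by (simp add: parts_defect_def mult.commute add.commute)

lemma parts_defect_diff:
  assumes "AI f" "AI p" "AI g" "x \<in> {0..pi}"
  shows "parts_defect x (\<lambda>t. f t - p t) g = parts_defect x f g - parts_defect x p g"
proof -
  have I: "integral {0..t} (\<lambda>t. f t - p t) = integral {0..t} f - integral {0..t} p" if "t \<in> {0..x}" for t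
    using assms that by (intro Henstock_Kurzweil_Integration.integral_diff AI_integrable_subset) auto
  have "integral {0..x} (\<lambda>t. (f t - p t) * integral {0..t} g + integral {0..t} (\<lambda>t. f t - p t) * g t)
    = integral {0..x} (\<lambda>t. (f t * integral {0..t} g + integral {0..t} f * g t)
        - (p t * integral {0..t} g + integral {0..t} p * g t))"
    by (rule integral_cong) (simp add: I algebra_simps)
  also have "\<dots> = integral {0..x} (\<lambda>t. f t * integral {0..t} g + integral {0..t} f * g t)
        - integral {0..x} (\<lambda>t. p t * integral {0..t} g + integral {0..t} p * g t)"
    using assms by (intro Henstock_Kurzweil_Integration.integral_diff AI_integrable_subset
        set_integral_add AI_parts) auto
  finally have A: "integral {0..x} (\<lambda>t. (f t - p t) * integral {0..t} g + integral {0..t} (\<lambda>t. f t - p t) * g t)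
      = \<dots>" .
  have B: "integral {0..x} (\<lambda>t. f t - p t) = integral {0..x} f - integral {0..x} p"
    using assms(4) by (intro I) auto
  show ?thesis unfolding parts_defect_def A B by (simp add: algebra_simps)
qed

text \<open>The product of the primitives and the two halves of the integrand contribute
  \<open>L1_norm f * L1_norm g\<close> each.\<close>

lemma parts_defect_bound:
  assumes "AI f" "AI g" "x \<in> {0..pi}"
  shows "cmod (parts_defect x f g) \<le> 3 * (L1_norm f * L1_norm g)"
proof -
  have 1: "cmod (integral {0..x} f * integral {0..x} g) \<le> L1_norm f * L1_norm g"
    using assms by (auto simp: norm_mult intro!: mult_mono norm_integral_le_L1_norm)
  have 2: "L1_norm (\<lambda>t. integral {0..t} f * g t) \<le> L1_norm f * L1_norm g"
    using assms by (intro L1_norm_mult_le AI_parts norm_integral_le_L1_norm) auto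
  have 3: "L1_norm (\<lambda>t. f t * integral {0..t} g) \<le> L1_norm f * L1_norm g"
    using L1_norm_mult_le[of f "\<lambda>t. integral {0..t} g" "L1_norm g"] AI_parts(1)[OF assms(1,2)] assms
      norm_integral_le_L1_norm[OF assms(2), of 0]
    by (simp add: mult.commute)
  have "cmod (integral {0..x} (\<lambda>t. f t * integral {0..t} g + integral {0..t} f * g t))
    \<le> L1_norm (\<lambda>t. f t * integral {0..t} g + integral {0..t} f * g t)"
    using assms by (intro norm_integral_le_L1_norm set_integral_add AI_parts) auto
  also have "\<dots> \<le> L1_norm (\<lambda>t. f t * integral {0..t} g) + L1_norm (\<lambda>t. integral {0..t} f * g t)"
    by (intro L1_norm_add_le AI_parts assms)
  finally show ?thesis
    unfolding parts_defect_def using 1 2 3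
    by (intro order_trans[OF norm_triangle_ineq4]) linarith
qed

lemma parts_defect_continuous:
  assumes f: "continuous_on {0..pi} f" and g: "continuous_on {0..pi} g" and x: "x \<in> {0..pi}"
  shows "parts_defect x f g = 0"
proof -
  let ?F = "\<lambda>t. integral {0..t} f" and ?G = "\<lambda>t. integral {0..t} g"
  have "((\<lambda>t. f t * ?G t + ?F t * g t) has_integral ?F x * ?G x - ?F 0 * ?G 0) {0..x}"
  proof (rule fundamental_theorem_of_calculus)
    fix t assume t: "t \<in> {0..x}"
    have "(?F has_vector_derivative f t) (at t within {0..x})"
      by (rule has_vector_derivative_within_subset[OF integral_has_vector_derivative[OF f]]) (use t x in auto)
    moreover have "(?G has_vector_derivative g t) (at t within {0..x})"
      by (rule has_vector_derivative_within_subset[OF integral_has_vector_derivative[OF g]]) (use t x in auto)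
    ultimately show "((\<lambda>t. ?F t * ?G t) has_vector_derivative f t * ?G t + ?F t * g t) (at t within {0..x})"
      using has_vector_derivative_mult by (fastforce simp: add.commute)
  qed (use x in auto)
  then show ?thesis by (simp add: parts_defect_def integral_unique)
qed

lemma parts_defect_eq_0:
  assumes f: "AI f" and g: "AI g" and x: "x \<in> {0..pi}"
  shows "parts_defect x f g = 0"
proof (rule ccontr)
  define d where "d = cmod (parts_defect x f g)"
  define S where "S = L1_norm f + L1_norm g + 1"
  assume "parts_defect x f g \<noteq> 0"
  then have d: "d > 0" by (simp add: d_def)
  have S: "S > 0" by (simp add: S_def add_nonneg_pos)
  \<comment> \<open>The factor \<open>6 * S\<close> brings the total error down to
    \<open>d / 2\<close>; the cap 1 keeps \<open>L1_norm p\<close> at most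
    \<open>L1_norm f + 1\<close>.\<close>
  define \<eta> where "\<eta> = min 1 (d / (6 * S))"
  have \<eta>: "\<eta> > 0" "\<eta> \<le> 1" "\<eta> * (6 * S) \<le> d" using d S by (auto simp: \<eta>_def min_def field_simps)
  obtain p where p: "polynomial_function p" "L1_norm (\<lambda>x. f x - p x) < \<eta>"
    using L1_approx_polynomial[OF f \<eta>(1)] .
  obtain q where q: "polynomial_function q" "L1_norm (\<lambda>x. g x - q x) < \<eta>"
    using L1_approx_polynomial[OF g \<eta>(1)] .
  note cont = continuous_on_polymonial_function[OF p(1)] continuous_on_polymonial_function[OF q(1)]
  note AIs = AI_continuous[OF cont(1)] AI_continuous[OF cont(2)]
  \<comment> \<open>Exchange \<open>f\<close> for \<open>p\<close>, then \<open>g\<close> for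
    \<open>q\<close>; the remaining defect of \<open>p\<close> and \<open>q\<close> is 0 by
    continuity.\<close>
  have "parts_defect x f g = parts_defect x (\<lambda>t. f t - p t) g + parts_defect x p (\<lambda>t. g t - q t)"
    using parts_defect_diff[OF f AIs(1) g x] parts_defect_diff[OF g AIs(2) AIs(1) x]
      parts_defect_continuous[OF cont x] parts_defect_commute[of x p] by simp
  moreover have "L1_norm p \<le> L1_norm f + L1_norm (\<lambda>x. f x - p x)"
    using L1_norm_diff_le[OF f set_integral_diff(1)[OF f AIs(1)]] by simp
  then have "L1_norm p \<le> L1_norm f + 1" using p(2) \<eta>(2) by simp
  then have "L1_norm p * L1_norm (\<lambda>x. g x - q x) \<le> (L1_norm f + 1) * \<eta>"
    using q(2) \<eta>(1) by (intro mult_mono) auto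
  moreover have "L1_norm (\<lambda>x. f x - p x) * L1_norm g \<le> \<eta> * L1_norm g"
    using p(2) \<eta>(1) by (intro mult_mono) auto
  ultimately have "d \<le> 3 * (\<eta> * L1_norm g) + 3 * ((L1_norm f + 1) * \<eta>)"
    unfolding d_def
    using parts_defect_bound[OF set_integral_diff(1)[OF f AIs(1)] g x]
      parts_defect_bound[OF AIs(1) set_integral_diff(1)[OF g AIs(2)] x]
    by (simp only:) (rule norm_triangle_le, linarith)
  also have "\<dots> = \<eta> * (6 * S) / 2" by (simp add: S_def algebra_simps)
  finally have "d \<le> \<eta> * (6 * S) / 2" .
  with \<eta>(3) d show False by linarith
qed

text \<open>Splitting off the initial values leaves a product of two primitives, whose defect is
  0.\<close>

lemma AC_mult:
  assumes F: "AC F f" and G: "AC G g"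
  shows "AC (\<lambda>x. F x * G x) (\<lambda>x. f x * G x + F x * g x)"
  unfolding AC_def
proof (intro conjI ballI)
  note f = AC_AI[OF F] and g = AC_AI[OF G]
  have 1: "AI (\<lambda>x. F x * g x)" "AI (\<lambda>x. G x * f x)"
    by (rule AI_mult_continuous[OF AC_continuous[OF F] g], rule AI_mult_continuous[OF AC_continuous[OF G] f])
  then show "AI (\<lambda>x. f x * G x + F x * g x)"
    by (intro set_integral_add) (simp_all add: mult.commute)
  fix x assume x: "x \<in> {0..pi}"
  have "integral {0..x} (\<lambda>t. f t * G t + F t * g t)
    = integral {0..x} (\<lambda>t. (f t * integral {0..t} g + integral {0..t} f * g t) + (G 0 * f t + F 0 * g t))"
    by (rule integral_cong) (use x in \<open>simp add: AC_integral[OF F] AC_integral[OF G] algebra_simps\<close>)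
  also have "\<dots> = integral {0..x} (\<lambda>t. f t * integral {0..t} g + integral {0..t} f * g t)
     + (G 0 * integral {0..x} f + F 0 * integral {0..x} g)"
  proof -
    have c: "AI (\<lambda>t. G 0 * f t)" "AI (\<lambda>t. F 0 * g t)"
      by (rule AI_mult_continuous[OF continuous_on_const f], rule AI_mult_continuous[OF continuous_on_const g])
    note p = set_integral_add(1)[OF AI_parts[OF f g]]
    have "x \<le> pi" using x by simp
    note i = AI_integrable_subset[OF _ this]
    show ?thesis
      using Henstock_Kurzweil_Integration.integral_add[OF i[OF p] i[OF set_integral_add(1)[OF c]]]
        Henstock_Kurzweil_Integration.integral_add[OF i[OF c(1)] i[OF c(2)]] by simp
  qed
  also have "integral {0..x} (\<lambda>t. f t * integral {0..t} g + integral {0..t} f * g t)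
      = integral {0..x} f * integral {0..x} g"
    using parts_defect_eq_0[OF f g x] by (simp add: parts_defect_def)
  finally show "F x * G x = F 0 * G 0 + integral {0..x} (\<lambda>t. f t * G t + F t * g t)"
    using x by (simp add: AC_integral[OF F] AC_integral[OF G] algebra_simps)
qed

lemma AC_cexp: "AC (\<lambda>x. exp (c * of_real x)) (\<lambda>x. c * exp (c * of_real x))"
proof (rule AC_C1)
  fix x :: real
  have "((\<lambda>w. exp (c * w)) has_field_derivative c * exp (c * of_real x)) (at (of_real x))"
    by (auto intro!: derivative_eq_intros)
  then show "((\<lambda>x. exp (c * of_real x)) has_vector_derivative c * exp (c * of_real x)) (at x)"
    by (rule has_vector_derivative_real_field)
qed (intro continuous_intros)

subsection \<open>Systems with oscillating coefficients\<close>

unbundle no fps_syntax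

text \<open>With \<open>B\<close> the primitive of \<open>A\<close>,
  \<open>A w = (B w)' - B w'\<close>, and the boundary term at 0 vanishes because
  \<open>B 0 = 0\<close>. Only the size of \<open>B\<close> enters, not the \<open>L1\<close> norm
  of \<open>A\<close>.\<close>

lemma integral_mult_AC_bound:
  assumes A: "AI A" and \<delta>: "\<And>x. x \<in> {0..pi} \<Longrightarrow> cmod (integral {0..x} A) \<le> \<delta>"
    and w: "AC w w'" and x: "x \<in> {0..pi}"
  shows "cmod (integral {0..x} (\<lambda>t. A t * w t)) \<le> \<delta> * (cmod (w x) + L1_norm w')"
proof -
  define B where "B = (\<lambda>x. integral {0..x} A)"
  have B: "AC B A" using AC_indefinite[OF A, of 0] by (simp add: B_def)
  have Bw: "AI (\<lambda>t. B t * w' t)"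
    by (rule AI_mult_continuous[OF AC_continuous[OF B] AC_AI[OF w]])
  have Aw: "AI (\<lambda>t. A t * w t)"
    using AI_mult_continuous[OF AC_continuous[OF w] A] by (simp add: mult.commute)
  have "B x * w x = integral {0..x} (\<lambda>t. A t * w t + B t * w' t)"
    using AC_integral[OF AC_mult[OF B w] x] by (simp add: B_def)
  also have "\<dots> = integral {0..x} (\<lambda>t. A t * w t) + integral {0..x} (\<lambda>t. B t * w' t)"
    using x by (intro Henstock_Kurzweil_Integration.integral_add AI_integrable_subset Aw Bw) auto
  finally have eq: "integral {0..x} (\<lambda>t. A t * w t) = B x * w x - integral {0..x} (\<lambda>t. B t * w' t)"
    by simp
  have "cmod (B x * w x) \<le> \<delta> * cmod (w x)"
    using \<delta>[OF x] by (simp add: B_def norm_mult mult_right_mono)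
  moreover have "cmod (integral {0..x} (\<lambda>t. B t * w' t)) \<le> \<delta> * L1_norm w'"
    using x \<delta> by (intro order_trans[OF norm_integral_le_L1_norm[OF Bw]] L1_norm_mult_le[OF AC_AI[OF w] Bw])
       (auto simp: B_def)
  ultimately show ?thesis unfolding eq
    by (intro order_trans[OF norm_triangle_ineq4]) (simp add: distrib_left)
qed

text \<open>The solution operator of \<open>w' = G\<close> under a boundary condition that gives
  \<open>w_i(0)\<close> as a combination of the increments \<open>w_j(pi) - w_j(0)\<close>. These
  increments are the integrals of \<open>G j\<close>, so the initial values are explicit and no
  linear system is left to solve.\<close>

definition green :: "('i::finite \<Rightarrow> 'i \<Rightarrow> complex) \<Rightarrow> ('i \<Rightarrow> real \<Rightarrow> complex) \<Rightarrow> 'i \<Rightarrow> real \<Rightarrow> complex" where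
  "green D G i x = (\<Sum>j\<in>UNIV. D i j * integral {0..pi} (G j)) + integral {0..x} (G i)"

lemma AC_green: "AI (G i) \<Longrightarrow> AC (green D G i) (G i)"
  using AC_indefinite[of "G i" "\<Sum>j\<in>UNIV. D i j * integral {0..pi} (G j)"] by (simp add: green_def[abs_def])

lemma green_bc: "green D G i 0 = (\<Sum>j\<in>UNIV. D i j * (green D G j pi - green D G j 0))"
  by (simp add: green_def)

lemma green_unique:
  assumes "\<And>i. AC (w i) (G i)" "\<And>i. w i 0 = (\<Sum>j\<in>UNIV. D i j * (w j pi - w j 0))" "x \<in> {0..pi}"
  shows "w i x = green D G i x"
  using AC_eq[OF assms(1) assms(3), of i] assms(2)[of i] by (simp add: green_def AC_integral[OF assms(1)])

lemma green_diff:
  assumes "\<And>i. AI (G i)" "\<And>i. AI (H i)" "x \<in> {0..pi}"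
  shows "green D (\<lambda>i t. G i t - H i t) i x = green D G i x - green D H i x"
proof -
  have "integral {0..y} (\<lambda>t. G i t - H i t) = integral {0..y} (G i) - integral {0..y} (H i)"
    if "y \<le> pi" for i y
    using that assms by (intro Henstock_Kurzweil_Integration.integral_diff AI_integrable_subset) auto
  from this[of pi] this[of x] assms(3) show ?thesis
    by (simp add: green_def sum_subtractf right_diff_distrib)
qed

text \<open>Only the primitives of \<open>G\<close> are assumed small, so cancellation in an
  oscillating \<open>G\<close> survives. The running integral contributes the 1, the boundary term
  the rest.\<close>

lemma green_bound:
  fixes D :: "'i::finite \<Rightarrow> 'i \<Rightarrow> complex"
  assumes D: "\<And>i j. cmod (D i j) \<le> d"
    and G: "\<And>i x. x \<in> {0..pi} \<Longrightarrow> cmod (integral {0..x} (G i)) \<le> \<eta>" and x: "x \<in> {0..pi}"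
  shows "cmod (green D G i x) \<le> (1 + real CARD('i) * d) * \<eta>"
proof -
  have "0 \<le> \<eta>" using order_trans[OF norm_ge_zero G[OF x]] .
  have "cmod (green D G i x) \<le> (\<Sum>j\<in>(UNIV::'i set). d * \<eta>) + \<eta>"
    unfolding green_def
  proof (intro order_trans[OF norm_triangle_ineq] add_mono order_trans[OF norm_sum] sum_mono G[OF x])
    fix j 
    show "cmod (D i j * integral {0..pi} (G j)) \<le> d * \<eta>"
      using D[of i j] G[of pi j] order_trans[OF norm_ge_zero D[of i j]] unfolding norm_mult
      by (intro mult_mono) auto
  qed
  then show ?thesis by (simp add: algebra_simps)
qed

text \<open>The system \<open>w\<^sub>i' = \<Sum>\<^sub>j A\<^sub>i\<^sub>j w\<^sub>j + F\<^sub>i\<close> with a boundary condition solved for the initial values. The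
  entries \<open>A\<^sub>i\<^sub>j\<close> are only bounded in \<open>L\<^sup>1\<close>, but their primitives are uniformly small.\<close>

locale oscillating_system =
  fixes A :: "'i::finite \<Rightarrow> 'i \<Rightarrow> real \<Rightarrow> complex" and D :: "'i \<Rightarrow> 'i \<Rightarrow> complex"
    and C d \<delta> m K :: real
  assumes AI_A: "AI (A i j)"
    and L1_A: "L1_norm (A i j) \<le> C"
    and osc: "x \<in> {0..pi} \<Longrightarrow> cmod (integral {0..x} (A i j)) \<le> \<delta>"
    and D_bound: "cmod (D i j) \<le> d"
    and m: "m = real CARD('i)"
    and K: "K = 1 + m * d"
    and small: "\<delta> * (m ^ 2 * K * (1 + K) * (1 + m * C)) \<le> 1/2"
begin

section \<open>A priori bounds for the system\<close>

lemma C_nonneg: "0 \<le> C" using order_trans[OF L1_norm_nonneg L1_A] .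
lemma d_nonneg: "0 \<le> d" using order_trans[OF norm_ge_zero D_bound] .
lemma \<delta>_nonneg: "0 \<le> \<delta>" using order_trans[OF norm_ge_zero osc[of 0]] by simp
lemma m_ge_1: "1 \<le> m" by (simp add: m Suc_leI)
lemma K_ge_1: "1 \<le> K" using d_nonneg m_ge_1 by (simp add: K)

text \<open>The assumption \<open>small\<close> is shaped by the contraction in
  \<open>solution_exists\<close>. Its additional factor \<open>m * (1 + K)\<close> is at least 2,
  which leaves the 1/4 that the a priori bound can absorb.\<close>

lemma small': "m * \<delta> * (K * (1 + m * C)) \<le> 1/4"
proof -
  have "m * \<delta> * (K * (1 + m * C)) * 2 \<le> m * \<delta> * (K * (1 + m * C)) * (m * (1 + K))"
    using m_ge_1 K_ge_1 C_nonneg \<delta>_nonneg mult_mono[of 1 m 2 "1 + K"] 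
    by (intro mult_left_mono mult_nonneg_nonneg) auto
  also have "\<dots> \<le> 1/2" using small by (simp add: power2_eq_square algebra_simps)
  finally show ?thesis by simp
qed

definition lin :: "('i \<Rightarrow> real \<Rightarrow> complex) \<Rightarrow> 'i \<Rightarrow> real \<Rightarrow> complex" where
  "lin w i x = (\<Sum>j\<in>UNIV. A i j x * w j x)"

definition solution :: "('i \<Rightarrow> real \<Rightarrow> complex) \<Rightarrow> ('i \<Rightarrow> real \<Rightarrow> complex) \<Rightarrow> bool" where
  "solution F w \<longleftrightarrow> (\<forall>i. AC (w i) (\<lambda>x. lin w i x + F i x)) \<and>
     (\<forall>i. w i 0 = (\<Sum>j\<in>UNIV. D i j * (w j pi - w j 0)))"

lemma AI_A_mult: "continuous_on {0..pi} w \<Longrightarrow> AI (\<lambda>x. A i j x * w x)"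
  using AI_mult_continuous[OF _ AI_A, of w] by (simp add: mult.commute)

lemma AI_lin: "(\<And>j. continuous_on {0..pi} (w j)) \<Longrightarrow> AI (lin w i)"
  unfolding lin_def[abs_def] by (intro absolutely_integrable_sum AI_A_mult) auto

lemma L1_lin_le:
  assumes "\<And>j. continuous_on {0..pi} (w j)" "\<And>j x. x \<in> {0..pi} \<Longrightarrow> cmod (w j x) \<le> N"
  shows "L1_norm (lin w i) \<le> m * C * N"
proof -
  have N: "0 \<le> N" using order_trans[OF norm_ge_zero assms(2)[of 0]] by simp
  have "L1_norm (lin w i) \<le> (\<Sum>j\<in>UNIV. L1_norm (\<lambda>x. A i j x * w j x))"
    unfolding lin_def[abs_def] by (intro L1_norm_sum_le AI_A_mult assms) auto
  also have "\<dots> \<le> (\<Sum>j\<in>(UNIV::'i set). N * C)"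
  proof (rule sum_mono)
    fix j
    have "L1_norm (\<lambda>x. w j x * A i j x) \<le> N * L1_norm (A i j)"
      using AI_A_mult[OF assms(1)] by (intro L1_norm_mult_le AI_A assms(2)) (simp_all add: mult.commute)
    also have "\<dots> \<le> N * C" by (intro mult_left_mono L1_A N)
    finally show "L1_norm (\<lambda>x. A i j x * w j x) \<le> N * C" by (simp add: mult.commute)
  qed
  finally show ?thesis by (simp add: m algebra_simps)
qed

text \<open>Compared with \<open>L1_lin_le\<close>, the factor \<open>C\<close> is replaced by the
  small \<open>\<delta>\<close>; the price is absolute continuity of \<open>w\<close> and a bound
  \<open>P\<close> on its derivative.\<close>

lemma integral_lin_bound:
  assumes w: "\<And>j. AC (w j) (w' j)" and N: "\<And>j x. x \<in> {0..pi} \<Longrightarrow> cmod (w j x) \<le> N"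
    and P: "\<And>j. L1_norm (w' j) \<le> P" and x: "x \<in> {0..pi}"
  shows "cmod (integral {0..x} (lin w i)) \<le> m * \<delta> * (N + P)"
proof -
  have "integral {0..x} (lin w i) = (\<Sum>j\<in>UNIV. integral {0..x} (\<lambda>x. A i j x * w j x))"
    unfolding lin_def[abs_def] using x
    by (intro integral_sum AI_integrable_subset AI_A_mult AC_continuous[OF w]) auto
  moreover have "cmod (integral {0..x} (\<lambda>x. A i j x * w j x)) \<le> \<delta> * (N + P)" for j
    using N[OF x, of j] P[of j] \<delta>_nonneg
    by (intro order_trans[OF integral_mult_AC_bound[OF AI_A osc w x]] mult_left_mono add_mono) auto
  ultimately have "cmod (integral {0..x} (lin w i)) \<le> (\<Sum>j\<in>(UNIV::'i set). \<delta> * (N + P))"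
    by (simp only:) (intro order_trans[OF norm_sum] sum_mono)
  then show ?thesis by (simp add: m)
qed

lemma green_lin_bound:
  assumes "\<And>j. AC (w j) (w' j)" "\<And>j x. x \<in> {0..pi} \<Longrightarrow> cmod (w j x) \<le> N"
    and "\<And>j. L1_norm (w' j) \<le> P" "x \<in> {0..pi}"
  shows "cmod (green D (lin w) i x) \<le> K * (m * \<delta> * (N + P))"
  unfolding K m by (rule green_bound[OF D_bound _ assms(4)]) (rule integral_lin_bound[OF assms(1-3), unfolded m])

lemma green_L1_bound:
  assumes "\<And>j. AI (G j)" "\<And>j. L1_norm (G j) \<le> P" "x \<in> {0..pi}"
  shows "cmod (green D G i x) \<le> K * P"
  unfolding K m by (rule green_bound[OF D_bound _ assms(3)])
     (rule order_trans[OF norm_integral_le_L1_norm[OF assms(1)] assms(2)], auto)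

lemma solution_continuous: "solution F w \<Longrightarrow> continuous_on {0..pi} (w i)"
  using AC_continuous unfolding solution_def by blast

text \<open>A solution is \<open>green\<close> applied to its own right-hand side, so by linearity
  the difference is \<open>green D (lin w)\<close>. The derivative bound needed for integration by
  parts comes from the equation: \<open>w'\<close> has \<open>L1\<close> norm at most
  \<open>m * C * N + \<phi>\<close>.\<close>

lemma solution_defect:
  assumes sol: "solution F w" and F: "\<And>i. AI (F i)" "\<And>i. L1_norm (F i) \<le> \<phi>"
    and N: "\<And>i x. x \<in> {0..pi} \<Longrightarrow> cmod (w i x) \<le> N" and x: "x \<in> {0..pi}"
  shows "cmod (w i x - green D F i x) \<le> K * (m * \<delta> * ((1 + m * C) * N + \<phi>))"
proof -
  note cont = solution_continuous[OF sol]
  have ac: "AC (w i) (\<lambda>x. lin w i x + F i x)" for i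
    using sol unfolding solution_def by blast
  have "green D (\<lambda>i x. lin w i x + F i x) i x - green D F i x
      = green D (\<lambda>i x. (lin w i x + F i x) - F i x) i x"
    by (rule green_diff[OF AC_AI[OF ac] F(1) x, symmetric])
  moreover have "w i x = green D (\<lambda>i x. lin w i x + F i x) i x"
    by (rule green_unique[OF ac _ x]) (use sol in \<open>unfold solution_def, blast\<close>)
  ultimately have eq: "w i x - green D F i x = green D (lin w) i x" by simp
  have "L1_norm (\<lambda>x. lin w i x + F i x) \<le> m * C * N + \<phi>" for i
    by (intro order_trans[OF L1_norm_add_le] add_mono L1_lin_le[OF cont N] AI_lin[OF cont] F)
  from green_lin_bound[OF ac N this x] show ?thesis by (simp add: eq algebra_simps)
qed

text \<open>Absorption: the supremum \<open>N\<close> of all components is finite by continuity, and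
  \<open>solution_defect\<close> gives \<open>N \<le> 2 * K * \<phi> + N / 2\<close>. Since zero
  source forces the zero solution, this is also the origin of uniqueness for the resolvent.\<close>

lemma solution_bound:
  assumes sol: "solution F w" and F: "\<And>i. AI (F i)" "\<And>i. L1_norm (F i) \<le> \<phi>" and x: "x \<in> {0..pi}"
  shows "cmod (w i x) \<le> 4 * K * \<phi>"
proof -
  define S where "S = (\<Union>i. (\<lambda>x. cmod (w i x)) ` {0..pi})"
  define N where "N = Sup S"
  have "compact ((\<lambda>x. cmod (w i x)) ` {0..pi})" for i
    by (intro compact_continuous_image continuous_intros solution_continuous[OF sol]) auto
  then have "bounded S" unfolding S_def by (intro bounded_UN compact_imp_bounded ballI) auto
  then have bdd: "bdd_above S" by (rule bounded_imp_bdd_above)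
  have N: "cmod (w i x) \<le> N" if "x \<in> {0..pi}" for i x
    unfolding N_def by (intro cSup_upper bdd) (unfold S_def, use that in blast)
  have N0: "0 \<le> N" using order_trans[OF norm_ge_zero N[OF x]] .
  have \<phi>0: "0 \<le> \<phi>" using order_trans[OF L1_norm_nonneg F(2)] .
  have "cmod (w i x) \<le> 2 * K * \<phi> + N / 2" if x: "x \<in> {0..pi}" for i x
  proof -
    have "cmod (w i x) \<le> cmod (green D F i x) + cmod (w i x - green D F i x)"
      using norm_triangle_ineq[of "green D F i x" "w i x - green D F i x"] by simp
    also have "\<dots> \<le> K * \<phi> + K * (m * \<delta> * ((1 + m * C) * N + \<phi>))"
      by (intro add_mono green_L1_bound F x solution_defect[OF sol F N x])
    also have "K * (m * \<delta> * ((1 + m * C) * N + \<phi>)) \<le> m * \<delta> * (K * (1 + m * C)) * (N + \<phi>)"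
    proof -
      have "(1 + m * C) * N + \<phi> \<le> (1 + m * C) * (N + \<phi>)"
        using C_nonneg \<phi>0 m_ge_1 by (simp add: algebra_simps)
      then have "(m * \<delta> * K) * ((1 + m * C) * N + \<phi>) \<le> (m * \<delta> * K) * ((1 + m * C) * (N + \<phi>))"
        using \<delta>_nonneg K_ge_1 m_ge_1 by (intro mult_left_mono) auto
      then show ?thesis by (simp add: ac_simps)
    qed
    also have "\<dots> \<le> 1/4 * (N + \<phi>)"
      by (intro mult_right_mono small') (use N0 \<phi>0 in auto)
    also have "\<dots> \<le> K * \<phi> + N / 2"
      using mult_right_mono[OF K_ge_1 \<phi>0] N0 \<phi>0 by simp
    finally show ?thesis by simp
  qed
  then have "N \<le> 2 * K * \<phi> + N / 2"
    unfolding N_def by (intro cSup_least) (auto simp: S_def)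
  then show ?thesis using N[OF x, of i] by simp
qed

lemma solution_approx:
  assumes "solution F w" "\<And>i. AI (F i)" "\<And>i. L1_norm (F i) \<le> \<phi>" "x \<in> {0..pi}"
  shows "cmod (w i x - green D F i x) \<le> \<delta> * (K * m * ((1 + m * C) * (4 * K) + 1)) * \<phi>"
  using solution_defect[OF assms(1-3) solution_bound[OF assms(1-3)] assms(4)]
  by (simp add: algebra_simps)

section \<open>Existence by Banach's fixed point theorem\<close>

definition clamp_pi :: "real \<Rightarrow> real" where "clamp_pi x = max 0 (min pi x)"

lemma clamp_pi: "clamp_pi x \<in> {0..pi}" "x \<in> {0..pi} \<Longrightarrow> clamp_pi x = x"
  by (auto simp: clamp_pi_def)

text \<open>The complete metric space at hand consists of bounded continuous functions on the whole
  line; constant continuation beyond 0 and \<open>pi\<close> embeds the continuous functions on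
  \<open>[0,pi]\<close> into it.\<close>

lemma clamped_bcontfun:
  assumes "continuous_on {0..pi} (f :: real \<Rightarrow> 'b::metric_space)"
  shows "(\<lambda>x. f (clamp_pi x)) \<in> bcontfun"
proof -
  have "continuous_on UNIV clamp_pi" unfolding clamp_pi_def by (intro continuous_intros)
  then have "continuous_on UNIV (\<lambda>x. f (clamp_pi x))"
    by (rule continuous_on_compose2[OF assms]) (use clamp_pi in auto)
  moreover have "bounded (f ` {0..pi})"
    by (intro compact_imp_bounded compact_continuous_image assms) auto
  then have "bounded (range (\<lambda>x. f (clamp_pi x)))"
    by (rule bounded_subset) (use clamp_pi in auto)
  ultimately show ?thesis by (simp add: bcontfun_def)
qed

text \<open>The fixed point map \<open>S\<close> need not be a contraction, but \<open>S \<circ> S\<close> is: after one application the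
  argument is absolutely continuous, so that \<open>integral_mult_AC_bound\<close> gains a factor \<open>\<delta>\<close>.\<close>

lemma solution_exists:
  assumes F: "\<And>i. AI (F i)"
  shows "\<exists>w. solution F w"
proof -
  define comp :: "(real \<Rightarrow>\<^sub>C (complex^'i)) \<Rightarrow> 'i \<Rightarrow> real \<Rightarrow> complex" where "comp W i x = W x $ i" for W i x
  define G where "G W i x = lin (comp W) i x + F i x" for W i x
  define S :: "(real \<Rightarrow>\<^sub>C (complex^'i)) \<Rightarrow> (real \<Rightarrow>\<^sub>C (complex^'i))" where
    "S W = Bcontfun (\<lambda>x. \<chi> i. green D (G W) i (clamp_pi x))" for W
  have cc: "continuous_on {0..pi} (comp W i)" for W i
    unfolding comp_def by (intro continuous_intros continuous_on_apply_bcontfun)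
  have AIG: "AI (G W i)" for W i
    unfolding G_def by (intro set_integral_add AI_lin cc F)
  have "continuous_on {0..pi} (\<lambda>x. \<chi> i. green D (G W) i x)" for W
    by (intro continuous_on_vec_lambda AC_continuous[OF AC_green] AIG)
  from clamped_bcontfun[OF this] have app: "S W x = (\<chi> i. green D (G W) i (clamp_pi x))" for W x
    unfolding S_def by (subst Bcontfun_inverse) auto
  have compS: "comp (S W) i x = green D (G W) i x" if "x \<in> {0..pi}" for W i x
    unfolding comp_def app using clamp_pi(2)[OF that] by simp
  have acS: "AC (comp (S W) i) (G W i)" for W i
    by (rule AC_cong[OF AC_green[OF AIG], of "{}"]) (auto simp: compS)
  have comp_dist: "cmod (comp V i x - comp W i x) \<le> dist V W" for V W i x
  proof -
    have "cmod (comp V i x - comp W i x) \<le> norm (V x - W x)"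
      unfolding comp_def using Finite_Cartesian_Product.norm_nth_le[of "V x - W x" i] by simp
    also have "\<dots> \<le> dist V W" using dist_bounded[of V x W] by (simp add: dist_norm)
    finally show ?thesis .
  qed
  have Gdiff: "(\<lambda>t. G V i t - G W i t) = lin (\<lambda>j t. comp V j t - comp W j t) i" for V W i
    by (simp add: G_def lin_def fun_eq_iff sum_subtractf right_diff_distrib)
  have Sdiff: "comp (S V) i x - comp (S W) i x = green D (lin (\<lambda>j t. comp V j t - comp W j t)) i x"
    if "x \<in> {0..pi}" for V W i x
    using green_diff[of "G V" "G W" x D i, OF AIG AIG that] by (simp add: compS[OF that] Gdiff)
  have contr: "dist (S (S V)) (S (S W)) \<le> 1/2 * dist V W" for V W
  proof (rule dist_bound)
    fix x
    define r where "r = dist V W"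
    define E where "E j t = comp (S V) j t - comp (S W) j t" for j t
    have r: "L1_norm (lin (\<lambda>j t. comp V j t - comp W j t) i) \<le> m * C * r" for i
      by (rule L1_lin_le) (auto intro!: continuous_intros cc comp_dist simp: r_def)
    have ac: "AC (E i) (lin (\<lambda>j t. comp V j t - comp W j t) i)" for i
      unfolding E_def Gdiff[symmetric] by (intro AC_diff acS)
    have Eb: "cmod (E i t) \<le> K * (m * C * r)" if "t \<in> {0..pi}" for i t
      unfolding E_def Sdiff[OF that] by (rule green_L1_bound[OF AC_AI[OF ac] r that])
    have "cmod (S (S V) x $ i - S (S W) x $ i) \<le> K * (m * \<delta> * (K * (m * C * r) + m * C * r))" for i
    proof -
      have "S (S V) x $ i - S (S W) x $ i = comp (S (S V)) i (clamp_pi x) - comp (S (S W)) i (clamp_pi x)"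
        unfolding compS[OF clamp_pi(1)] by (simp add: app)
      also have "\<dots> = green D (lin E) i (clamp_pi x)"
        by (simp add: Sdiff[OF clamp_pi(1)] E_def[abs_def])
      finally show ?thesis using green_lin_bound[OF ac Eb r clamp_pi(1)] by simp
    qed
    then have "(\<Sum>i\<in>UNIV. cmod ((S (S V) x - S (S W) x) $ i)) \<le> m * (K * (m * \<delta> * (K * (m * C * r) + m * C * r)))"
      using sum_bounded_above[of UNIV "\<lambda>i. cmod ((S (S V) x - S (S W) x) $ i)"] by (simp add: m)
    then have "dist (S (S V) x) (S (S W) x) \<le> m * (K * (m * \<delta> * (K * (m * C * r) + m * C * r)))"
      \<comment> \<open>The Euclidean norm is at most the sum of the moduli of the components; this
        produces the second factor \<open>m\<close> in \<open>small\<close>.\<close>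
      unfolding dist_norm norm_vec_def[of "S (S V) x - S (S W) x"]
      by (intro order_trans[OF L2_set_le_sum]) auto
    also have "\<dots> = \<delta> * (m ^ 2 * K * (1 + K)) * (m * C) * r"
      by (simp add: power2_eq_square algebra_simps)
    also have "\<dots> \<le> \<delta> * (m ^ 2 * K * (1 + K)) * (1 + m * C) * r"
      using \<delta>_nonneg K_ge_1 m_ge_1 C_nonneg
      by (intro mult_right_mono mult_left_mono mult_nonneg_nonneg) (auto simp: r_def)
    also have "\<dots> \<le> 1/2 * r"
      using small by (intro mult_right_mono) (auto simp: r_def mult.assoc)
    finally show "dist (S (S V) x) (S (S W) x) \<le> 1/2 * dist V W" by (simp add: r_def)
  qed
  have "\<exists>!W. (S \<circ> S) W = W"
    by (rule banach_fix_type[of "1/2"]) (use contr in auto)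
  then obtain W where W: "S (S W) = W" "\<And>V. S (S V) = V \<Longrightarrow> V = W" by auto
  \<comment> \<open>\<open>S W\<close> is again a fixed point of \<open>S \<circ> S\<close>, hence
    equal to \<open>W\<close> by uniqueness.\<close>
  have fixW: "S W = W" by (rule W(2)) (simp add: W(1))
  have compW: "comp W i x = green D (G W) i x" if "x \<in> {0..pi}" for i x
    using compS[OF that, of W i] by (simp only: fixW)
  have p0: "0 \<in> {0..pi}" by simp
  have "solution F (comp W)"
    unfolding solution_def
  proof (intro conjI allI)
    show "AC (comp W i) (\<lambda>x. lin (comp W) i x + F i x)" for i
      using acS[of W i] by (simp add: fixW G_def[abs_def])
    show "comp W i 0 = (\<Sum>j\<in>UNIV. D i j * (comp W j pi - comp W j 0))" for i
      unfolding compW[OF p0] by (subst green_bc) (simp add: compW)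
  qed
  then show ?thesis by blast
qed

end

subsection \<open>The Riemann-Lebesgue lemma and square integrable functions\<close>

text \<open>The frequencies to come are \<open>2ik\<close> and \<open>-2ik\<close> with bounded
  \<open>Im k\<close>, so uniformity is needed over complex \<open>c\<close> in a vertical strip,
  where \<open>exp (c t)\<close> is bounded by \<open>M\<close>. A polynomial approximant of
  \<open>Q\<close> gains \<open>1/c\<close> by integration by parts; the rest is at most
  \<open>M\<close> times the \<open>L1\<close> error.\<close>

lemma riemann_lebesgue:
  assumes Q: "AI Q" and \<eta>: "\<eta> > 0"
  obtains R where "\<And>c x. R \<le> cmod c \<Longrightarrow> \<bar>Re c\<bar> \<le> \<rho> \<Longrightarrow> x \<in> {0..pi} \<Longrightarrow>
    cmod (integral {0..x} (\<lambda>t. Q t * exp (c * of_real t))) \<le> \<eta>"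
proof -
  define M where "M = exp (\<rho> * pi)"
  have M: "M > 0" by (simp add: M_def)
  obtain p where p: "polynomial_function p" "L1_norm (\<lambda>x. Q x - p x) < \<eta> / (2 * M)"
    using L1_approx_polynomial[OF Q, of "\<eta> / (2 * M)"] \<eta> M by auto
  obtain p' where p': "polynomial_function p'" "\<And>x. (p has_vector_derivative p' x) (at x)"
    using has_vector_derivative_polynomial_function[OF p(1)] by blast
  have AC_p: "AC p p'" by (intro AC_C1 p' continuous_on_polymonial_function)
  have "compact (p ` {0..pi})"
    by (intro compact_continuous_image continuous_on_polymonial_function p) auto
  then obtain P where P: "\<And>x. x \<in> {0..pi} \<Longrightarrow> cmod (p x) \<le> P"
    by (meson bounded_iff compact_imp_bounded imageI)
  have P0: "0 \<le> P" using order_trans[OF norm_ge_zero P[of 0]] by simp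
  \<comment> \<open>Two boundary terms of size at most \<open>M * P\<close>, and the integral
    against \<open>p'\<close>.\<close>
  define B where "B = M * (2 * P + L1_norm p')"
  have B0: "0 \<le> B" using M P0 by (simp add: B_def)
  show ?thesis
  \<comment> \<open>Beyond \<open>2 * B / \<eta>\<close> the polynomial part is at most
    \<open>\<eta> / 2\<close>; the added 1 keeps \<open>c\<close> away from 0.\<close>
  proof (rule that[of "2 * B / \<eta> + 1"])
    fix c :: complex and x :: real
    assume c: "2 * B / \<eta> + 1 \<le> cmod c" "\<bar>Re c\<bar> \<le> \<rho>" and x: "x \<in> {0..pi}"
    have c0: "cmod c > 0" using c(1) B0 \<eta> by (smt (verit) divide_nonneg_pos)
    define e where "e = (\<lambda>t. exp (c * complex_of_real t))"
    have AC_e: "AC e (\<lambda>t. c * e t)" unfolding e_def by (rule AC_cexp)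
    note ce = AC_continuous[OF AC_e]
    have e: "cmod (e t) \<le> M" if "t \<in> {0..pi}" for t
    proof -
      have "Re c * t \<le> \<rho> * pi" using c(2) that by (intro mult_mono) auto
      then show ?thesis by (simp add: e_def M_def)
    qed
    note prod = AC_mult[OF AC_e AC_p]
    have AIs: "AI (\<lambda>t. e t * p t)" "AI (\<lambda>t. e t * p' t)" "AI (\<lambda>t. e t * (Q t - p t))"
      by (intro AI_mult_continuous ce AC_AI[OF AC_p] set_integral_diff Q AI_continuous AC_continuous[OF AC_p])+
    note x' = x[simplified, THEN conjunct2]
    have "e x * p x - e 0 * p 0 = integral {0..x} (\<lambda>t. c * (e t * p t) + e t * p' t)"
      using AC_integral[OF prod x] by (simp add: mult.assoc)
    also have "\<dots> = c * integral {0..x} (\<lambda>t. e t * p t) + integral {0..x} (\<lambda>t. e t * p' t)"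
      using x AIs by (subst Henstock_Kurzweil_Integration.integral_add)
         (auto intro!: AI_integrable_subset[OF _ x'] AI_mult_continuous)
    finally have eq: "c * integral {0..x} (\<lambda>t. e t * p t) = e x * p x - e 0 * p 0 - integral {0..x} (\<lambda>t. e t * p' t)"
      by simp
    have "cmod (e t * p t) \<le> M * P" if "t \<in> {0..pi}" for t
      unfolding norm_mult using e[OF that] P[OF that] M by (intro mult_mono) auto
    note this[OF x] this[of 0]
    moreover have "cmod (integral {0..x} (\<lambda>t. e t * p' t)) \<le> M * L1_norm p'"
      using x e by (intro order_trans[OF norm_integral_le_L1_norm[OF AIs(2)]] L1_norm_mult_le AIs AC_AI[OF AC_p]) auto
    ultimately have "cmod (c * integral {0..x} (\<lambda>t. e t * p t)) \<le> B"
      unfolding eq B_def using norm_triangle_ineq4[of "e x * p x - e 0 * p 0" "integral {0..x} (\<lambda>t. e t * p' t)"]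
        norm_triangle_ineq4[of "e x * p x" "e 0 * p 0"] by (simp add: distrib_left)
    then have "cmod c * cmod (integral {0..x} (\<lambda>t. e t * p t)) \<le> B" by (simp add: norm_mult)
    moreover have "B \<le> cmod c * (\<eta> / 2)"
    proof -
      have "2 * B / \<eta> \<le> cmod c" using c(1) by simp
      then show ?thesis using \<eta> by (simp add: field_simps)
    qed
    ultimately have 1: "cmod (integral {0..x} (\<lambda>t. e t * p t)) \<le> \<eta> / 2"
      using c0 mult_le_cancel_left_pos order_trans by blast
    have "cmod (integral {0..x} (\<lambda>t. e t * (Q t - p t))) \<le> M * L1_norm (\<lambda>t. Q t - p t)"
      using x e AC_AI[OF AC_p] AI_continuous[OF AC_continuous[OF AC_p]]
      by (intro order_trans[OF norm_integral_le_L1_norm[OF AIs(3)]] L1_norm_mult_le AIs set_integral_diff Q) auto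
    also have "\<dots> \<le> \<eta> / 2" using p(2) M by (simp add: field_simps)
    finally have 2: "cmod (integral {0..x} (\<lambda>t. e t * (Q t - p t))) \<le> \<eta> / 2" .
    have "integral {0..x} (\<lambda>t. Q t * e t) = integral {0..x} (\<lambda>t. e t * (Q t - p t) + e t * p t)"
      by (rule integral_cong) (simp add: algebra_simps)
    also have "\<dots> = integral {0..x} (\<lambda>t. e t * (Q t - p t)) + integral {0..x} (\<lambda>t. e t * p t)"
      by (intro Henstock_Kurzweil_Integration.integral_add AI_integrable_subset[OF _ x'] AIs)
    finally show "cmod (integral {0..x} (\<lambda>t. Q t * exp (c * of_real t))) \<le> \<eta>"
      using 1 2 norm_triangle_ineq[of "integral {0..x} (\<lambda>t. e t * (Q t - p t))" "integral {0..x} (\<lambda>t. e t * p t)"]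
      by (simp add: e_def)
  qed
qed

section \<open>Square integrable functions\<close>

lemma L2_on_measurable: "L2_on f \<Longrightarrow> f \<in> borel_measurable (lebesgue_on {0..pi})"
  by (simp add: L2_on_def measurable_on_iff_borel_measurable)

lemma L2_on_AI: 
  assumes "L2_on f"
  shows "AI f"
proof (rule measurable_bounded_by_integrable_imp_absolutely_integrable[OF L2_on_measurable[OF assms]])
  show "(\<lambda>x. 1 + (cmod (f x))\<^sup>2) integrable_on {0..pi}"
    using assms by (intro integrable_add) (auto simp: L2_on_def)
  show "norm (f x) \<le> 1 + (cmod (f x))\<^sup>2" for x
  proof -
    have "2 * cmod (f x) \<le> (cmod (f x))\<^sup>2 + 1" using sum_squares_bound[of "cmod (f x)" 1] by simp
    then show ?thesis using norm_ge_zero[of "f x"] by linarith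
  qed
qed auto

lemma L2_on_AI_square:
  assumes "L2_on f"
  shows "AI (\<lambda>x. (f x)\<^sup>2)"
proof (rule measurable_bounded_by_integrable_imp_absolutely_integrable)
  show "(\<lambda>x. (f x)\<^sup>2) \<in> borel_measurable (lebesgue_on {0..pi})"
    using L2_on_measurable[OF assms] by measurable
qed (use assms in \<open>auto simp: L2_on_def norm_power\<close>)

lemma L2_on_diff:
  assumes f: "L2_on f" and g: "L2_on g"
  shows "L2_on (\<lambda>x. f x - g x)"
proof -
  have m: "(\<lambda>x. f x - g x) \<in> borel_measurable (lebesgue_on {0..pi})"
    using L2_on_measurable[OF f] L2_on_measurable[OF g] by measurable
  have "(\<lambda>x. (cmod (f x - g x))\<^sup>2) integrable_on {0..pi}"
  proof (rule measurable_bounded_by_integrable_imp_integrable)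
    show "(\<lambda>x. (cmod (f x - g x))\<^sup>2) \<in> borel_measurable (lebesgue_on {0..pi})"
      using m by measurable
    show "(\<lambda>x. 2 * (cmod (f x))\<^sup>2 + 2 * (cmod (g x))\<^sup>2) integrable_on {0..pi}"
      using f g by (intro integrable_add integrable_on_mult_right) (auto simp: L2_on_def)
    fix x
    have "(cmod (f x - g x))\<^sup>2 \<le> (cmod (f x) + cmod (g x))\<^sup>2"
      by (intro power_mono norm_triangle_ineq4) auto
    also have "\<dots> \<le> 2 * (cmod (f x))\<^sup>2 + 2 * (cmod (g x))\<^sup>2"
      using sum_squares_bound[of "cmod (f x)" "cmod (g x)"] by (simp add: power2_sum)
    finally show "norm ((cmod (f x - g x))\<^sup>2) \<le> 2 * (cmod (f x))\<^sup>2 + 2 * (cmod (g x))\<^sup>2" by simp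
  qed auto
  with m show ?thesis by (simp add: L2_on_def measurable_on_iff_borel_measurable)
qed

lemma L2_on_continuous:
  assumes "continuous_on {0..pi} f"
  shows "L2_on f"
  using assms unfolding L2_on_def
  by (auto intro!: integrable_continuous_real continuous_intros continuous_imp_measurable_on_sets_lebesgue
      simp: measurable_on_iff_borel_measurable)

subsection \<open>Reduction of the Hill equation to a system\<close>

text \<open>The equation forces \<open>l = z y - f\<close> almost everywhere, so \<open>l\<close>
  can be eliminated; conversely this choice of \<open>l\<close> is square integrable because
  \<open>y\<close> is continuous and \<open>f\<close> is in \<open>L2\<close>.\<close>

lemma solves_iff:
  assumes Q: "L2_on Q" and f: "L2_on f"
  shows "solves Q v0 b z f y \<longleftrightarrow>
    (\<forall>x. x \<notin> {0..pi} \<longrightarrow> y x = 0) \<and>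
    (\<exists>u. AC y (\<lambda>t. Q t * y t + u t) \<and>
         AC u (\<lambda>t. f t - Q t * u t - (Q t)\<^sup>2 * y t + (v0 - z) * y t) \<and> bc_holds b y u)"
  (is "_ \<longleftrightarrow> ?out \<and> (\<exists>u. ?sys u)")
proof
  assume "solves Q v0 b z f y"
  then obtain l u g M N where out: ?out
    and y: "AC y (\<lambda>t. Q t * y t + u t)" and u: "AC u g" and bc: "bc_holds b y u"
    and N: "negligible N" "\<And>x. x \<in> {0..pi} - N \<Longrightarrow> l x = - g x - Q x * u x - (Q x)^2 * y x + v0 * y x"
    and M: "negligible M" "\<And>x. x \<in> {0..pi} - M \<Longrightarrow> z * y x - l x = f x"
    unfolding solves_def in_dom_def AC_def by blast
  have "AC u (\<lambda>t. f t - Q t * u t - (Q t)\<^sup>2 * y t + (v0 - z) * y t)"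
  proof (rule AC_cong[OF u negligible_Un[OF M(1) N(1)] refl])
    fix x assume "x \<in> {0..pi} - (M \<union> N)"
    with M(2)[of x] N(2)[of x] show "f x - Q x * u x - (Q x)\<^sup>2 * y x + (v0 - z) * y x = g x"
      by (auto simp: algebra_simps)
  qed
  with out y bc show "?out \<and> (\<exists>u. ?sys u)" by blast
next
  assume "?out \<and> (\<exists>u. ?sys u)"
  then obtain u where out: ?out and y: "AC y (\<lambda>t. Q t * y t + u t)"
    and u: "AC u (\<lambda>t. f t - Q t * u t - (Q t)\<^sup>2 * y t + (v0 - z) * y t)" and bc: "bc_holds b y u"
    by blast
  define g where "g = (\<lambda>t. f t - Q t * u t - (Q t)\<^sup>2 * y t + (v0 - z) * y t)"
  define l where "l = (\<lambda>t. z * y t - f t)"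
  have L2: "L2_on l" unfolding l_def
    by (intro L2_on_diff f L2_on_continuous continuous_intros AC_continuous[OF y])
  have "AI g" "\<forall>x\<in>{0..pi}. u x = u 0 + integral {0..x} g"
    using u unfolding g_def AC_def by blast+
  moreover have "\<exists>N. negligible N \<and> (\<forall>x\<in>{0..pi} - N. l x = - g x - Q x * u x - (Q x)\<^sup>2 * y x + v0 * y x)"
    by (intro exI[of _ "{}"]) (simp add: l_def g_def algebra_simps)
  ultimately have "in_dom Q v0 b y l"
    using out L2 bc y[unfolded AC_def] unfolding in_dom_def by blast
  moreover have "\<forall>x\<in>{0..pi} - {}. z * y x - l x = f x" by (simp add: l_def)
  ultimately show "solves Q v0 b z f y"
    unfolding solves_def using negligible_empty by blast
qed

section \<open>Amplitudes as new unknowns, indexed by \<open>bool\<close>\<close>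

definition sg :: "bool \<Rightarrow> complex" where "sg i = (if i then 1 else - 1)"

definition wave :: "complex \<Rightarrow> bool \<Rightarrow> real \<Rightarrow> complex" where
  "wave k i x = exp (sg i * \<i> * k * of_real x)"

lemma sg_simps [simp]: "sg True = 1" "sg False = -1" "sg (\<not> i) = - sg i" "sg i * sg i = 1"
  "sg i \<noteq> 0" "cmod (sg i) = 1" "sg i * (sg i * a) = a"
  by (auto simp: sg_def)

lemma wave_0 [simp]: "wave k i 0 = 1"
  by (simp add: wave_def)

lemma wave_inverse [simp]: "wave k (\<not> i) x * wave k i x = 1" "wave k i x * wave k (\<not> i) x = 1"
  "wave k False x * wave k True x = 1" "wave k True x * wave k False x = 1"
  by (simp_all add: wave_def flip: exp_add)

lemma AC_wave: "AC (wave k i) (\<lambda>x. sg i * \<i> * k * wave k i x)"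
  using AC_cexp[of "sg i * \<i> * k"] by (simp add: wave_def[abs_def])

lemma wave_bound:
  assumes "\<bar>Im k\<bar> \<le> 1" "x \<in> {0..pi}"
  shows "cmod (wave k i x) \<le> exp pi"
proof -
  have "\<bar>Im k * x\<bar> \<le> 1 * pi"
    unfolding abs_mult using assms by (intro mult_mono) auto
  then show ?thesis by (cases i) (auto simp: wave_def)
qed

text \<open>For \<open>z = k\<^sup>2\<close> the amplitudes \<open>w\<^sub>\<plusminus> = exp (\<plusminus>ikx) (y \<plusminus> i u / k)\<close>, with \<open>True\<close> for the upper sign, satisfy
  \<open>w\<^sub>\<plusminus>' = Q exp (\<plusminus>2ikx) w\<^sub>\<mp> \<plusminus> (i/k) exp (\<plusminus>ikx) ((v0 - Q\<^sup>2) y + f)\<close>, so the only coefficient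
  that is not \<open>O(1/k)\<close> carries an oscillating exponential.\<close>

definition potential_matrix :: "(real \<Rightarrow> complex) \<Rightarrow> complex \<Rightarrow> complex \<Rightarrow> bool \<Rightarrow> bool \<Rightarrow> real \<Rightarrow> complex" where
  "potential_matrix Q v0 k i j x = (if i = j then 0 else Q x * (wave k i x)\<^sup>2)
     + sg i * \<i> / (2 * k) * (wave k i x * wave k (\<not> j) x) * (v0 - (Q x)\<^sup>2)"

definition source :: "complex \<Rightarrow> (real \<Rightarrow> complex) \<Rightarrow> bool \<Rightarrow> real \<Rightarrow> complex" where
  "source k f i x = sg i * \<i> / k * wave k i x * f x"

definition amplitude :: "complex \<Rightarrow> (real \<Rightarrow> complex) \<Rightarrow> (real \<Rightarrow> complex) \<Rightarrow> bool \<Rightarrow> real \<Rightarrow> complex" where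
  "amplitude k y u i x = wave k i x * (y x + sg i * \<i> / k * u x)"

text \<open>Together with \<open>quasi_of\<close> the inverse of \<open>amplitude\<close>: removing
  the exponentials gives \<open>y + iu/k\<close> and \<open>y - iu/k\<close>, whose half sum is
  \<open>y\<close> and whose difference determines \<open>u\<close>.\<close>

definition sol_of :: "complex \<Rightarrow> (bool \<Rightarrow> real \<Rightarrow> complex) \<Rightarrow> real \<Rightarrow> complex" where
  "sol_of k w x = (wave k False x * w True x + wave k True x * w False x) / 2"

definition quasi_of :: "complex \<Rightarrow> (bool \<Rightarrow> real \<Rightarrow> complex) \<Rightarrow> real \<Rightarrow> complex" where
  "quasi_of k w x = k * (wave k False x * w True x - wave k True x * w False x) / (2 * \<i>)"

lemma sol_of_amplitude: 
  "sol_of k (amplitude k y u) x = y x"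
proof -
  have "sol_of k (amplitude k y u) x = ((wave k False x * wave k True x) * (y x + \<i> / k * u x) + (wave k True x * wave k False x) * (y x - \<i> / k * u x)) / 2"
    unfolding sol_of_def amplitude_def by (simp only: sg_simps mult.assoc) simp
  then show ?thesis unfolding wave_inverse by simp
qed

lemma amplitude_sol_of:
  assumes "k \<noteq> 0"
  shows "amplitude k (sol_of k w) (quasi_of k w) i x = w i x"
proof -
  have "sol_of k w x + sg i * \<i> / k * quasi_of k w x = wave k (\<not> i) x * w i x"
    using assms by (cases i) (simp_all add: sol_of_def quasi_of_def field_simps)
  then show ?thesis by (simp add: amplitude_def flip: mult.assoc)
qed

text \<open>With \<open>q j\<close> equal to \<open>y + iu/k\<close> or \<open>y - iu/k\<close>,
  \<open>y\<close> is the mean of \<open>q i\<close> and \<open>q (\<not> i)\<close>. The zero-order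
  term is thus shared equally between both amplitudes, which is the factor 1/2 in
  \<open>potential_matrix\<close>; opposite waves cancel by \<open>W * V = 1\<close>.\<close>

lemma lin_potential_amplitude:
  assumes "k \<noteq> 0"
  shows "(\<Sum>j\<in>UNIV. potential_matrix Q v0 k i j x * amplitude k y u j x) 
    = wave k i x * (Q x * (y x - sg i * \<i> / k * u x) + sg i * \<i> / k * (v0 - (Q x)\<^sup>2) * y x)"
proof -
  define r where "r = sg i * \<i> / k * (v0 - (Q x)\<^sup>2)"
  define W where "W = wave k i x"
  define V where "V = wave k (\<not> i) x"
  have WV: "W * V = 1" "V * W = 1" by (simp_all add: W_def V_def)
  define q where "q j = y x + sg j * \<i> / k * u x" for j
  have *: "(\<Sum>j\<in>UNIV. g j) = g i + g (\<not> i)" for g :: "bool \<Rightarrow> complex"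
    by (cases i) (simp_all add: UNIV_bool add.commute)
  have m1: "potential_matrix Q v0 k i i x = r / 2 * (W * V)"
    by (simp add: potential_matrix_def r_def W_def V_def)
  have m2: "potential_matrix Q v0 k i (\<not> i) x = Q x * W\<^sup>2 + r / 2 * W\<^sup>2"
    by (simp add: potential_matrix_def r_def W_def power2_eq_square mult_ac)
  have a: "amplitude k y u i x = W * q i" "amplitude k y u (\<not> i) x = V * q (\<not> i)"
    by (simp_all add: amplitude_def W_def V_def q_def)
  have "(\<Sum>j\<in>UNIV. potential_matrix Q v0 k i j x * amplitude k y u j x) 
    = W * (W * V) * (r / 2 * q i) + W * (W * V) * ((Q x + r / 2) * q (\<not> i))"
    unfolding * m1 m2 a by (simp add: algebra_simps power2_eq_square)
  also have "\<dots> = W * (Q x * q (\<not> i) + r * ((q i + q (\<not> i)) / 2))"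
    unfolding WV by (simp add: algebra_simps)
  also have "(q i + q (\<not> i)) / 2 = y x" by (simp add: q_def)
  finally show ?thesis by (simp add: r_def W_def q_def)
qed

text \<open>Differentiating the exponential yields \<open>s i k y - u\<close> with
  \<open>s = sg i\<close>. This cancels \<open>u\<close> in \<open>y'\<close> and the large term
  \<open>- k^2 y\<close> in \<open>u'\<close>, which carries the factor
  \<open>s i / k\<close>.\<close>

lemma AC_amplitude:
  assumes k: "k \<noteq> 0" and y: "AC y (\<lambda>t. Q t * y t + u t)"
    and u: "AC u (\<lambda>t. f t - Q t * u t - (Q t)\<^sup>2 * y t + (v0 - k\<^sup>2) * y t)"
  shows "AC (amplitude k y u i)
    (\<lambda>x. (\<Sum>j\<in>UNIV. potential_matrix Q v0 k i j x * amplitude k y u j x) + source k f i x)"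
proof (rule AC_cong[OF AC_mult[OF AC_wave AC_add[OF y AC_mult_const[OF u]]] negligible_empty])
  show "amplitude k y u i x = wave k i x * (y x + sg i * \<i> / k * u x)" for x
    by (simp add: amplitude_def)
  fix x
  define W where "W = wave k i x"
  define s where "s = sg i"
  have s: "s * s = 1" by (simp add: s_def)
  have "s * \<i> * k * W * (y x + s * \<i> / k * u x) = W * (s * \<i> * k * y x - (s * s) * u x)"
    using k by (simp add: field_simps)
  also have "\<dots> = W * (s * \<i> * k * y x - u x)" using s by simp
  finally show "(\<Sum>j\<in>UNIV. potential_matrix Q v0 k i j x * amplitude k y u j x) + source k f i x
     = sg i * \<i> * k * wave k i x * (y x + sg i * \<i> / k * u x) +
        wave k i x * (Q x * y x + u x + sg i * \<i> / k * (f x - Q x * u x - (Q x)\<^sup>2 * y x + (v0 - k\<^sup>2) * y x))"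
    using k unfolding lin_potential_amplitude[OF k] source_def W_def[symmetric] s_def[symmetric]
    by (simp add: field_simps power2_eq_square)
qed

text \<open>Undoing the oscillating factors gives first-order equations for \<open>p i\<close>, that
  is for \<open>y + iu/k\<close> and \<open>y - iu/k\<close>; their half sum and their scaled
  difference are the equations for \<open>y\<close> and \<open>u\<close>.\<close>

lemma AC_sol_of:
  assumes k: "k \<noteq> 0" 
    and w: "\<And>i. AC (w i) (\<lambda>x. (\<Sum>j\<in>UNIV. potential_matrix Q v0 k i j x * w j x) + source k f i x)"
  shows "AC (sol_of k w) (\<lambda>t. Q t * sol_of k w t + quasi_of k w t)" (is ?thesis1)
    and "AC (quasi_of k w) (\<lambda>t. f t - Q t * quasi_of k w t - (Q t)\<^sup>2 * sol_of k w t
           + (v0 - k\<^sup>2) * sol_of k w t)" (is ?thesis2)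
proof -
  define y where "y = sol_of k w"
  define u where "u = quasi_of k w"
  have amp: "amplitude k y u = w"
    by (simp add: fun_eq_iff amplitude_sol_of[OF k] y_def u_def)
  define p where "p i x = y x + sg i * \<i> / k * u x" for i x
  have p: "AC (p i) (\<lambda>x. - sg i * \<i> * k * p i x + Q x * p (\<not> i) x
      + sg i * \<i> / k * ((v0 - (Q x)\<^sup>2) * y x + f x))" for i
  proof (rule AC_cong[OF AC_mult[OF AC_wave[of k "\<not> i"] w[of i]] negligible_empty])
    fix x
    define W where "W = wave k i x"
    define V where "V = wave k (\<not> i) x"
    have WV: "V * W = 1" by (simp_all add: W_def V_def)
    have wi: "w i x = W * p i x"
      unfolding amp[symmetric] by (simp add: amplitude_def p_def W_def)
    then show "p i x = wave k (\<not> i) x * w i x"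
      using WV by (simp add: V_def flip: mult.assoc)
    have d: "(\<Sum>j\<in>UNIV. potential_matrix Q v0 k i j x * w j x) + source k f i x
       = W * (Q x * p (\<not> i) x + sg i * \<i> / k * ((v0 - (Q x)\<^sup>2) * y x + f x))"
      using lin_potential_amplitude[OF k, of Q v0 i x y u] unfolding amp
      by (simp add: source_def p_def W_def algebra_simps)
    show "- sg i * \<i> * k * p i x + Q x * p (\<not> i) x + sg i * \<i> / k * ((v0 - (Q x)\<^sup>2) * y x + f x)
      = sg (\<not> i) * \<i> * k * wave k (\<not> i) x * w i x +
        wave k (\<not> i) x * ((\<Sum>j\<in>UNIV. potential_matrix Q v0 k i j x * w j x) + source k f i x)"
      unfolding d wi V_def[symmetric] mult.assoc[symmetric] WV
      using WV by (simp add: mult.assoc)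
  qed
  have y: "y x = 1/2 * (p True x + p False x)" for x by (simp add: p_def)
  have u: "u x = k / (2 * \<i>) * (p True x - p False x)" for x using k by (simp add: p_def)
  show ?thesis1
    unfolding y_def[symmetric] u_def[symmetric]
    by (rule AC_cong[OF AC_mult_const[OF AC_add[OF p[of True] p[of False]], of "1/2"] negligible_empty])
       (use k in \<open>simp_all add: p_def field_simps\<close>)
  show ?thesis2
    unfolding y_def[symmetric] u_def[symmetric]
    by (rule AC_cong[OF AC_mult_const[OF AC_diff[OF p[of True] p[of False]], of "k / (2 * \<i>)"] negligible_empty])
       (use k in \<open>simp_all add: p_def field_simps power2_eq_square\<close>)
qed

text \<open>Put \<open>e_i = wave k i pi\<close> and \<open>e = wave k True pi\<close>. Periodicity
  reads \<open>w_i(pi) = e_i w_i(0)\<close>, so the increment is \<open>(e_i - 1) w_i(0)\<close>;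
  antiperiodicity gives \<open>- (e_i + 1) w_i(0)\<close>. The Dirichlet conditions are that the two
  amplitudes have sum 0 at 0 and that \<open>w_True + e^2 w_False\<close> vanishes at
  \<open>pi\<close>; hence that combination of the increments equals
  \<open>- (1 - e^2) w_True(0)\<close>.\<close>

fun boundary_matrix :: "bc \<Rightarrow> complex \<Rightarrow> bool \<Rightarrow> bool \<Rightarrow> complex" where
  "boundary_matrix PerPlus k i j = (if i = j then 1 / (wave k i pi - 1) else 0)"
| "boundary_matrix PerMinus k i j = (if i = j then - 1 / (wave k i pi + 1) else 0)"
| "boundary_matrix Dir k i j = - sg i * (if j then 1 else (wave k True pi)\<^sup>2) / (1 - (wave k True pi)\<^sup>2)"

text \<open>The single condition \<open>e^2 \<noteq> 1\<close> excludes the zeros of all the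
  denominators \<open>e - 1\<close>, \<open>e + 1\<close> and \<open>1 - e^2\<close>, and of the
  first two for the reciprocal \<open>e'\<close> as well.\<close>

lemma bc_iff:
  assumes k: "k \<noteq> 0" and nz: "(wave k True pi)\<^sup>2 \<noteq> 1" and w: "w = amplitude k y u"
  shows "bc_holds b y u \<longleftrightarrow> (\<forall>i. w i 0 = (\<Sum>j\<in>UNIV. boundary_matrix b k i j * (w j pi - w j 0)))"
proof -
  define e where "e = wave k True pi"
  define e' where "e' = wave k False pi"
  have ee: "e * e' = 1" "e\<^sup>2 \<noteq> 1" by (simp_all add: e_def e'_def nz)
  have ne: "e \<noteq> 1" "e \<noteq> -1" using ee(2) by auto
  have ne': "e' \<noteq> 1" "e' \<noteq> -1"
  proof -
    show "e' \<noteq> 1" using ee(1) ne(1) by auto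
    show "e' \<noteq> -1"
    proof
      assume "e' = -1"
      with ee(1) have "- e = 1" by simp
      with ne(2) show False by (metis minus_minus)
    qed
  qed
  have e0: "e \<noteq> 0" "e' \<noteq> 0" using ee by auto
  define a where "a = \<i> / k * u 0"
  define c where "c = \<i> / k * u pi"
  have w0: "w True 0 = y 0 + a" "w False 0 = y 0 - a" by (simp_all add: w amplitude_def a_def)
  have wp: "w True pi = e * (y pi + c)" "w False pi = e' * (y pi - c)" 
    by (simp_all add: w amplitude_def c_def e_def e'_def)
  have ac: "a = c \<longleftrightarrow> u 0 = u pi" "a = - c \<longleftrightarrow> u 0 = - u pi"
  proof -
    have ik: "\<i> / k \<noteq> 0" using k by simp
    show "a = c \<longleftrightarrow> u 0 = u pi"
      unfolding a_def c_def by (rule mult_left_cancel[OF ik])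
    show "a = - c \<longleftrightarrow> u 0 = - u pi"
      unfolding a_def c_def mult_minus_right[symmetric] by (rule mult_left_cancel[OF ik])
  qed
  have all: "(\<forall>i. P i) \<longleftrightarrow> P True \<and> P False" for P :: "bool \<Rightarrow> bool" by (metis (full_types))
  have pm: "\<alpha> + \<beta> = \<gamma> + \<delta> \<and> \<alpha> - \<beta> = \<gamma> - \<delta> \<longleftrightarrow> \<alpha> = \<gamma> \<and> \<beta> = \<delta>" for \<alpha> \<beta> \<gamma> \<delta> :: complex
  proof
    assume h: "\<alpha> + \<beta> = \<gamma> + \<delta> \<and> \<alpha> - \<beta> = \<gamma> - \<delta>"
    have "2 * \<alpha> = (\<alpha> + \<beta>) + (\<alpha> - \<beta>)" by simp
    also have "\<dots> = 2 * \<gamma>" using h by simp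
    finally show "\<alpha> = \<gamma> \<and> \<beta> = \<delta>" using h by simp
  qed simp
  show ?thesis
  proof (cases b)
    case PerPlus
    have key: "p = 1 / (s - 1) * (s * q - p) \<longleftrightarrow> p = q" if "s \<noteq> 1" "s \<noteq> 0" for p q s :: complex
    proof -
      have "p = 1 / (s - 1) * (s * q - p) \<longleftrightarrow> s * p = s * q" using that by (auto simp: field_simps)
      then show ?thesis using that by simp
    qed
    have "(\<forall>i. w i 0 = (\<Sum>j\<in>UNIV. boundary_matrix b k i j * (w j pi - w j 0)))
      \<longleftrightarrow> w True 0 = 1 / (e - 1) * (w True pi - w True 0) \<and> w False 0 = 1 / (e' - 1) * (w False pi - w False 0)"
      unfolding all PerPlus by (simp add: UNIV_bool e_def e'_def)
    also have "\<dots> \<longleftrightarrow> y 0 + a = y pi + c \<and> y 0 - a = y pi - c"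
      unfolding w0 wp key[OF ne(1) e0(1)] key[OF ne'(1) e0(2)] by (rule refl)
    also have "\<dots> \<longleftrightarrow> bc_holds b y u"
      unfolding pm ac PerPlus by auto
    finally show ?thesis by simp
  next
    case PerMinus
    have key: "p = - 1 / (s + 1) * (s * q - p) \<longleftrightarrow> p = - q" if "s \<noteq> -1" "s \<noteq> 0" for p q s :: complex
    proof -
      have "s + 1 \<noteq> 0" using that by (simp add: add_eq_0_iff2)
      then have "p = - 1 / (s + 1) * (s * q - p) \<longleftrightarrow> s * p = s * (- q)" 
        by (auto simp: field_simps add_eq_0_iff)
      then show ?thesis unfolding mult_left_cancel[OF that(2)] .
    qed
    have "(\<forall>i. w i 0 = (\<Sum>j\<in>UNIV. boundary_matrix b k i j * (w j pi - w j 0)))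
      \<longleftrightarrow> w True 0 = - 1 / (e + 1) * (w True pi - w True 0) \<and> w False 0 = - 1 / (e' + 1) * (w False pi - w False 0)"
      unfolding all PerMinus by (simp add: UNIV_bool e_def e'_def)
    also have "\<dots> \<longleftrightarrow> y 0 + a = - y pi + - c \<and> y 0 - a = - y pi - - c"
      unfolding w0 wp key[OF ne(2) e0(1)] key[OF ne'(2) e0(2)] by simp
    also have "\<dots> \<longleftrightarrow> bc_holds b y u"
      unfolding pm ac PerMinus by auto
    finally show ?thesis by simp
  next
    case Dir
    have nz': "1 - e\<^sup>2 \<noteq> 0" using ee(2) by simp
    \<comment> \<open>By \<open>e * e' = 1\<close> the quasi-derivative drops out of this
      combination, leaving \<open>2 * e * y pi\<close>.\<close>
    have eq: "bc_holds b y u \<longleftrightarrow> w True 0 + w False 0 = 0 \<and> w True pi + e\<^sup>2 * w False pi = 0"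
    proof -
      have "w True pi + e\<^sup>2 * w False pi = e * (y pi + c) + e * (e * e') * (y pi - c)"
        by (simp add: wp power2_eq_square mult.assoc)
      also have "\<dots> = 2 * (e * y pi)" unfolding ee(1) by (simp add: algebra_simps)
      finally show ?thesis using e0 by (simp add: Dir w0)
    qed
    let ?T = "w True 0" and ?F = "w False 0"
    let ?X = "(w True pi - ?T) + e\<^sup>2 * (w False pi - ?F)"
    have "(\<forall>i. w i 0 = (\<Sum>j\<in>UNIV. boundary_matrix b k i j * (w j pi - w j 0)))
      \<longleftrightarrow> ?T = - ?X / (1 - e\<^sup>2) \<and> ?F = ?X / (1 - e\<^sup>2)"
      by (simp add: Dir all UNIV_bool e_def[symmetric] add_divide_distrib diff_divide_distrib algebra_simps)
    also have "\<dots> \<longleftrightarrow> ?T + ?F = 0 \<and> ?T * (1 - e\<^sup>2) = - ?X"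
    proof -
      have "T = - X / D \<and> F = X / D \<longleftrightarrow> T + F = 0 \<and> T * D = - X" if "D \<noteq> 0" for T F X D :: complex
      proof -
        have "F = X / D \<longleftrightarrow> T + F = 0" if "T = - X / D" using that by (auto simp: add_eq_0_iff)
        moreover have "T = - X / D \<longleftrightarrow> T * D = - X" using that by (rule nonzero_eq_divide_eq)
        ultimately show ?thesis by blast
      qed
      from this[OF nz'] show ?thesis .
    qed
    also have "\<dots> \<longleftrightarrow> ?T + ?F = 0 \<and> w True pi + e\<^sup>2 * w False pi = 0"
    proof (rule conj_cong[OF refl])
      assume "?T + ?F = 0"
      then have F: "?F = - ?T" by (simp add: add_eq_0_iff)
      have "?T * (1 - e\<^sup>2) + ?X = w True pi + e\<^sup>2 * w False pi" unfolding F by (simp add: algebra_simps)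
      then show "?T * (1 - e\<^sup>2) = - ?X \<longleftrightarrow> w True pi + e\<^sup>2 * w False pi = 0"
        by (metis add_eq_0_iff2)
    qed
    finally show ?thesis by (simp add: eq)
  qed
qed

subsection \<open>Estimates on the circle\<close>

text \<open>The integer \<open>n\<close> disappears by periodicity of the exponential, so the gap
  below is independent of \<open>n\<close>.\<close>

lemma wave_pi_shift: "(wave (of_nat n + \<kappa>) True pi)\<^sup>2 = exp (2 * of_real pi * \<i> * \<kappa>)"
proof -
  have "(wave (of_nat n + \<kappa>) True pi)\<^sup>2 = exp (2 * of_real pi * \<i> * \<kappa> + 2 * of_nat n * of_real pi * \<i>)"
    by (simp add: wave_def exp_double[symmetric] algebra_simps)
  also have "\<dots> = exp (2 * of_real pi * \<i> * \<kappa>)"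
    using exp_integer_2pi[of "of_nat n"] by (simp add: exp_add mult_ac)
  finally show ?thesis .
qed

text \<open>The zeros of \<open>1 - exp (2\<pi>i\<kappa>)\<close> are the integers, none of which
  lies in the annulus; compactness turns this into a positive minimum.\<close>

lemma exp_gap:
  obtains c where "c > 0"
    "\<And>\<kappa>. 1/3 \<le> cmod \<kappa> \<Longrightarrow> cmod \<kappa> \<le> 2/3 \<Longrightarrow> c \<le> cmod (1 - exp (2 * of_real pi * \<i> * \<kappa>))"
proof -
  define S where "S = cball (0::complex) (2/3) - ball 0 (1/3)"
  define g where "g = (\<lambda>\<kappa>. cmod (1 - exp (2 * of_real pi * \<i> * \<kappa>)))"
  have S: "compact S" unfolding S_def by (intro compact_diff) auto
  have "of_real (1/2) \<in> S" by (simp add: S_def)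
  then have ne: "S \<noteq> {}" by blast
  have "continuous_on S g" unfolding g_def by (intro continuous_intros)
  then obtain \<kappa>0 where \<kappa>0: "\<kappa>0 \<in> S" "\<And>\<kappa>. \<kappa> \<in> S \<Longrightarrow> g \<kappa>0 \<le> g \<kappa>"
    using continuous_attains_inf[OF S ne] by blast
  have "exp (2 * of_real pi * \<i> * \<kappa>0) \<noteq> 1"
  proof
    assume "exp (2 * of_real pi * \<i> * \<kappa>0) = 1"
    then obtain j :: int where "Im \<kappa>0 = 0" "Re \<kappa>0 = of_int j"
      by (auto simp: exp_eq_1)
    then have "cmod \<kappa>0 = \<bar>of_int j\<bar>" by (simp add: cmod_eq_Re)
    moreover have "1/3 \<le> cmod \<kappa>0" "cmod \<kappa>0 \<le> 2/3" using \<kappa>0(1) by (auto simp: S_def)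
    ultimately have "\<bar>j\<bar> > 0" "\<bar>j\<bar> < 1" by linarith+
    then show False by simp
  qed
  then have "g \<kappa>0 > 0" by (simp add: g_def)
  then show ?thesis using \<kappa>0(2) by (intro that[of "g \<kappa>0"]) (auto simp: g_def S_def)
qed

text \<open>In \<open>z - n^2 = \<kappa> (k + n)\<close> the principal root has
  \<open>Re k \<ge> 0\<close>, so \<open>k + n\<close> has modulus at least \<open>n\<close> and
  \<open>\<kappa>\<close> at most 1. Then \<open>k + n\<close> has modulus between
  \<open>2n - 1\<close> and \<open>2n + 1\<close>, and \<open>\<kappa>\<close> between
  \<open>n / (2n + 1)\<close> and \<open>n / (2n - 1)\<close>; the upper value is at most 2/3
  exactly from \<open>n = 2\<close> on.\<close>

lemma csqrt_near:
  assumes n: "n \<ge> 2" and z: "cmod (z - (of_nat n)\<^sup>2) = real n"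
  obtains \<kappa> where "csqrt z = of_nat n + \<kappa>" "1/3 \<le> cmod \<kappa>" "cmod \<kappa> \<le> 2/3"
proof -
  define k where "k = csqrt z"
  define \<kappa> where "\<kappa> = k - of_nat n"
  have Re: "Re k \<ge> 0" using csqrt_principal[of z] by (auto simp: k_def)
  have "z - (of_nat n)\<^sup>2 = \<kappa> * (k + of_nat n)"
    by (simp add: \<kappa>_def k_def algebra_simps flip: power2_eq_square)
  then have prod: "cmod \<kappa> * cmod (k + of_nat n) = real n"
    using z by (simp add: norm_mult)
  have "real n \<le> cmod (k + of_nat n)"
    using complex_Re_le_cmod[of "k + of_nat n"] Re by simp
  then have "cmod \<kappa> * real n \<le> real n"
    using mult_left_mono[of "real n" "cmod (k + of_nat n)" "cmod \<kappa>"] prod by simp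
  then have \<kappa>1: "cmod \<kappa> \<le> 1" using n by simp
  have kn: "k + of_nat n = of_nat (2 * n) + \<kappa>" by (simp add: \<kappa>_def)
  have lo: "2 * real n - 1 \<le> cmod (k + of_nat n)"
    unfolding kn using norm_triangle_ineq2[of "of_nat (2 * n)" "- \<kappa>"] \<kappa>1 norm_of_nat[of "2*n", where 'a=complex]
    by simp
  have hi: "cmod (k + of_nat n) \<le> 2 * real n + 1"
    unfolding kn using norm_triangle_ineq[of "of_nat (2 * n)" \<kappa>] \<kappa>1 norm_of_nat[of "2*n", where 'a=complex]
    by simp
  have "cmod \<kappa> * (2 * real n - 1) \<le> real n"
    using mult_left_mono[OF lo, of "cmod \<kappa>"] prod by simp
  also have "\<dots> \<le> 2/3 * (2 * real n - 1)" using n by simp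
  finally have 1: "cmod \<kappa> \<le> 2/3" by (rule mult_right_le_imp_le) (use n in simp)
  have "1/3 * (2 * real n + 1) \<le> real n" using n by simp
  also have "\<dots> \<le> cmod \<kappa> * (2 * real n + 1)"
    using mult_left_mono[OF hi, of "cmod \<kappa>"] prod by simp
  finally have "1/3 \<le> cmod \<kappa>" by (rule mult_right_le_imp_le) simp
  with 1 show ?thesis by (intro that[of \<kappa>]) (simp_all add: \<kappa>_def k_def)
qed

text \<open>For either sign \<open>i\<close> the periodic denominators are factors of
  \<open>e_i^2 - 1\<close>, the cofactor being at most \<open>M + 1\<close>. Passing from the gap at
  \<open>e\<close> to that at \<open>1/e\<close> costs \<open>M^2\<close>, whence the third
  power.\<close>

lemma boundary_matrix_bound:
  assumes k: "\<bar>Im k\<bar> \<le> 1" and c: "c > 0" "c \<le> cmod (1 - (wave k True pi)\<^sup>2)"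
  shows "cmod (boundary_matrix b k i j) \<le> (exp pi + 1) ^ 3 / c"
proof -
  define M where "M = exp pi"
  have M: "M \<ge> 1" by (simp add: M_def)
  have e: "cmod (wave k i pi) \<le> M" for i unfolding M_def by (rule wave_bound[OF k]) simp
  have e2: "c \<le> M\<^sup>2 * cmod (1 - (wave k i pi)\<^sup>2)" for i
  proof -
    have M2: "1 \<le> M\<^sup>2" using M by simp
    have "cmod (1 - (wave k True pi)\<^sup>2) \<le> M\<^sup>2 * cmod (1 - (wave k i pi)\<^sup>2)"
    proof (cases i)
      case True
      then show ?thesis using mult_right_mono[OF M2, of "cmod (1 - (wave k True pi)\<^sup>2)"] by simp
    next
      case False
      have "1 - (wave k True pi)\<^sup>2 = - (wave k True pi)\<^sup>2 * (1 - (wave k False pi)\<^sup>2)"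
        by (simp add: algebra_simps flip: power_mult_distrib)
      then have "cmod (1 - (wave k True pi)\<^sup>2) = (cmod (wave k True pi))\<^sup>2 * cmod (1 - (wave k False pi)\<^sup>2)"
        by (simp add: norm_mult norm_power)
      also have "\<dots> \<le> M\<^sup>2 * cmod (1 - (wave k False pi)\<^sup>2)"
        by (intro mult_right_mono power_mono e) auto
      finally show ?thesis using False by simp
    qed
    with c(2) show ?thesis by linarith
  qed
  have inv: "cmod (1 / t) \<le> (M + 1) ^ 3 / c" if "(wave k i pi)\<^sup>2 - 1 = s * t" "cmod s \<le> M + 1" for i s t
  proof -
    have "c \<le> M\<^sup>2 * (cmod s * cmod t)"
      using e2[of i] unfolding norm_mult[symmetric] that(1)[symmetric] by (simp only: norm_minus_commute)
    also have "\<dots> \<le> (M + 1)\<^sup>2 * ((M + 1) * cmod t)"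
      using M that(2) by (intro mult_mono power_mono) auto
    finally have *: "c \<le> (M + 1) ^ 3 * cmod t" by (simp add: power3_eq_cube power2_eq_square mult_ac)
    have "t \<noteq> 0" using * c(1) by auto
    then show ?thesis using * c(1) by (simp add: norm_divide field_simps)
  qed
  have pos: "0 \<le> (M + 1) ^ 3 / c" using M c(1) by simp
  have "cmod (wave k i pi + 1) \<le> M + 1" "cmod (wave k i pi - 1) \<le> M + 1" for i
    using norm_triangle_ineq[of "wave k i pi" 1] norm_triangle_ineq4[of "wave k i pi" 1] e[of i] by auto
  note s = this
  have "cmod (boundary_matrix b k i j) \<le> (M + 1) ^ 3 / c"
  proof (cases b)
    case PerPlus
    have "cmod (1 / (wave k i pi - 1)) \<le> (M + 1) ^ 3 / c"
      by (rule inv[OF _ s(1)[of i]]) (simp add: power2_eq_square algebra_simps)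
    with pos show ?thesis unfolding PerPlus by (cases "i = j") auto
  next
    case PerMinus
    have "cmod (1 / (wave k i pi + 1)) \<le> (M + 1) ^ 3 / c"
      by (rule inv[OF _ s(2)[of i]]) (simp add: power2_eq_square algebra_simps)
    with pos show ?thesis unfolding PerMinus by (cases "i = j") (auto simp: norm_divide)
  next
    case Dir
    have "cmod (if j then 1 else (wave k True pi)\<^sup>2) \<le> (M + 1) ^ 3"
    proof -
      have "(cmod (wave k True pi))\<^sup>2 \<le> (M + 1)\<^sup>2" using e[of True] M by (intro power_mono) auto
      also have "\<dots> \<le> (M + 1) ^ 3" using M by (intro power_increasing) auto
      finally show ?thesis using M by (simp add: norm_power)
    qed
    then have "cmod (if j then 1 else (wave k True pi)\<^sup>2) / cmod (1 - (wave k True pi)\<^sup>2) \<le> (M + 1) ^ 3 / c"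
      using c M by (intro frac_le) auto
    then show ?thesis by (simp add: Dir norm_divide norm_mult)
  qed
  then show ?thesis by (simp add: M_def)
qed

text \<open>Two mechanisms are kept apart: the part with \<open>Q\<close> is small only through its
  oscillation, whereas the part with \<open>Q^2\<close>, merely integrable, is small in
  \<open>L1\<close> by its factor \<open>1/k\<close>.\<close>

lemma potential_matrix_bounds:
  assumes Q: "AI Q" and r: "AI (\<lambda>x. v0 - (Q x)\<^sup>2)" and k: "\<bar>Im k\<bar> \<le> 1" "1 \<le> cmod k"
  shows "AI (potential_matrix Q v0 k i j)"
    and "L1_norm (potential_matrix Q v0 k i j) \<le> exp (2 * pi) * (L1_norm Q + L1_norm (\<lambda>x. v0 - (Q x)\<^sup>2))"
    and "x \<in> {0..pi} \<Longrightarrow> cmod (integral {0..x} (\<lambda>t. Q t * exp (2 * sg i * \<i> * k * of_real t))) \<le> \<eta> \<Longrightarrow> 0 \<le> \<eta> \<Longrightarrow>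
      cmod (integral {0..x} (potential_matrix Q v0 k i j)) \<le> \<eta> + exp (2 * pi) * L1_norm (\<lambda>x. v0 - (Q x)\<^sup>2) / (2 * cmod k)"
proof -
  let ?r = "\<lambda>x. v0 - (Q x)\<^sup>2"
  define h1 where "h1 x = (if i = j then 0 else (wave k i x)\<^sup>2)" for x
  define h2 where "h2 x = sg i * \<i> / (2 * k) * (wave k i x * wave k (\<not> j) x)" for x
  have pm: "potential_matrix Q v0 k i j = (\<lambda>x. h1 x * Q x + h2 x * ?r x)"
    by (auto simp: potential_matrix_def fun_eq_iff h1_def h2_def)
  note cw = AC_continuous[OF AC_wave]
  have c1: "continuous_on {0..pi} h1" unfolding h1_def by (cases "i = j") (auto intro!: continuous_intros cw)
  have c2: "continuous_on {0..pi} h2" unfolding h2_def by (intro continuous_intros cw)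
  have E: "exp (2 * pi) = exp pi * exp pi" by (simp flip: exp_add)
  have ww: "cmod (wave k i x * wave k j x) \<le> exp (2 * pi)" if "x \<in> {0..pi}" for x i j
    unfolding norm_mult E by (intro mult_mono wave_bound[OF k(1) that]) auto
  have b1: "cmod (h1 x) \<le> exp (2 * pi)" if "x \<in> {0..pi}" for x
    using ww[OF that, of i i] by (auto simp: h1_def power2_eq_square)
  have b2: "cmod (h2 x) \<le> exp (2 * pi) / (2 * cmod k)" if "x \<in> {0..pi}" for x
    using divide_right_mono[OF ww[OF that, of i "\<not> j"], of "2 * cmod k"]
    by (simp add: h2_def norm_mult norm_divide)
  have A1: "AI (\<lambda>x. h1 x * Q x)" by (rule AI_mult_continuous[OF c1 Q])
  have A2: "AI (\<lambda>x. h2 x * ?r x)" by (rule AI_mult_continuous[OF c2 r])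
  show "AI (potential_matrix Q v0 k i j)" unfolding pm by (rule set_integral_add(1)[OF A1 A2])
  have L2: "L1_norm (\<lambda>x. h2 x * ?r x) \<le> exp (2 * pi) / (2 * cmod k) * L1_norm ?r"
    by (rule L1_norm_mult_le[OF r A2 b2])
  have "exp (2 * pi) / (2 * cmod k) \<le> exp (2 * pi) / 1"
    using k(2) by (intro divide_left_mono) auto
  then have "exp (2 * pi) / (2 * cmod k) * L1_norm ?r \<le> exp (2 * pi) * L1_norm ?r"
    by (intro mult_right_mono) auto
  then show "L1_norm (potential_matrix Q v0 k i j) \<le> exp (2 * pi) * (L1_norm Q + L1_norm ?r)"
    unfolding pm using L1_norm_add_le[OF A1 A2] L1_norm_mult_le[OF Q A1 b1] L2 by (simp add: distrib_left)
  assume x: "x \<in> {0..pi}" and \<eta>: "cmod (integral {0..x} (\<lambda>t. Q t * exp (2 * sg i * \<i> * k * of_real t))) \<le> \<eta>" "0 \<le> \<eta>"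
  have eq: "(\<lambda>t. (wave k i t)\<^sup>2 * Q t) = (\<lambda>t. Q t * exp (2 * sg i * \<i> * k * of_real t))"
    by (simp add: fun_eq_iff wave_def mult_ac flip: exp_double)
  then have 1: "cmod (integral {0..x} (\<lambda>x. h1 x * Q x)) \<le> \<eta>"
  proof (cases "i = j")
    case False
    then have "(\<lambda>x. h1 x * Q x) = (\<lambda>t. (wave k i t)\<^sup>2 * Q t)" by (simp add: h1_def)
    with \<eta>(1) show ?thesis by (simp only: eq)
  qed (use \<eta>(2) in \<open>simp add: h1_def\<close>)
  have 2: "cmod (integral {0..x} (\<lambda>x. h2 x * ?r x)) \<le> exp (2 * pi) * L1_norm ?r / (2 * cmod k)"
    using norm_integral_le_L1_norm[OF A2, of 0 x] L2 x by simp
  have "integral {0..x} (potential_matrix Q v0 k i j) = integral {0..x} (\<lambda>x. h1 x * Q x) + integral {0..x} (\<lambda>x. h2 x * ?r x)"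
    unfolding pm using x by (intro Henstock_Kurzweil_Integration.integral_add AI_integrable_subset A1 A2) auto
  then show "cmod (integral {0..x} (potential_matrix Q v0 k i j)) \<le> \<eta> + exp (2 * pi) * L1_norm ?r / (2 * cmod k)"
    using 1 2 norm_triangle_ineq[of "integral {0..x} (\<lambda>x. h1 x * Q x)" "integral {0..x} (\<lambda>x. h2 x * ?r x)"] by simp
qed

lemma source_bound:
  assumes f: "AI f" and k: "\<bar>Im k\<bar> \<le> 1"
  shows "AI (source k f i)" and "L1_norm (source k f i) \<le> exp pi / cmod k * L1_norm f"
proof -
  have s: "source k f i = (\<lambda>x. (sg i * \<i> / k * wave k i x) * f x)"
    by (simp add: source_def fun_eq_iff)
  show A: "AI (source k f i)" unfolding s
    by (intro AI_mult_continuous f continuous_intros AC_continuous[OF AC_wave])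
  show "L1_norm (source k f i) \<le> exp pi / cmod k * L1_norm f"
    unfolding s
    by (rule L1_norm_mult_le[OF f A[unfolded s]])
       (auto simp: norm_mult norm_divide intro!: divide_right_mono wave_bound[OF k])
qed

lemma sol_of_diff_bound:
  assumes "\<bar>Im k\<bar> \<le> 1" "x \<in> {0..pi}" "\<And>i. cmod (w i x - v i x) \<le> B"
  shows "cmod (sol_of k w x - sol_of k v x) \<le> exp pi * B"
proof -
  have "cmod (wave k (\<not> i) x * (w i x - v i x)) \<le> exp pi * B" for i
    unfolding norm_mult by (intro mult_mono wave_bound[OF assms(1,2)] assms(3)) auto
  from this[of True] this[of False]
  have "cmod (wave k False x * (w True x - v True x) + wave k True x * (w False x - v False x)) \<le> 2 * (exp pi * B)"
    by (intro norm_triangle_le) simp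
  moreover have eq: "sol_of k w x - sol_of k v x
    = (wave k False x * (w True x - v True x) + wave k True x * (w False x - v False x)) / 2"
    by (simp add: sol_of_def field_simps)
  ultimately show ?thesis unfolding eq norm_divide by simp
qed

text \<open>The solution for zero potential; it is the common approximation of both resolvents.\<close>

definition free_sol :: "bc \<Rightarrow> complex \<Rightarrow> (real \<Rightarrow> complex) \<Rightarrow> real \<Rightarrow> complex" where
  "free_sol b k f = sol_of k (green (boundary_matrix b k) (source k f))"

section \<open>Transfer between the system and the Hill equation\<close>

lemma solution_imp_solves:
  assumes Q: "L2_on Q" and f: "L2_on f" and k: "k \<noteq> 0" "(wave k True pi)\<^sup>2 \<noteq> 1"
    and w: "\<And>i. AC (w i) (\<lambda>x. (\<Sum>j\<in>UNIV. potential_matrix Q v0 k i j x * w j x) + source k f i x)"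
    and bc: "\<forall>i. w i 0 = (\<Sum>j\<in>UNIV. boundary_matrix b k i j * (w j pi - w j 0))"
  shows "solves Q v0 b (k\<^sup>2) f (\<lambda>x. if x \<in> {0..pi} then sol_of k w x else 0)"
    (is "solves _ _ _ _ _ ?y")
proof -
  have amp: "w = amplitude k (sol_of k w) (quasi_of k w)"
    by (simp add: fun_eq_iff amplitude_sol_of[OF k(1)])
  have "bc_holds b (sol_of k w) (quasi_of k w)"
    using bc unfolding bc_iff[OF k amp] .
  then have "bc_holds b ?y (quasi_of k w)" by (cases b) auto
  moreover have "AC ?y (\<lambda>t. Q t * ?y t + quasi_of k w t)"
    by (rule AC_cong[OF AC_sol_of(1)[OF k(1) w] negligible_empty]) auto
  moreover have "AC (quasi_of k w)
      (\<lambda>t. f t - Q t * quasi_of k w t - (Q t)\<^sup>2 * ?y t + (v0 - k\<^sup>2) * ?y t)"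
    by (rule AC_cong[OF AC_sol_of(2)[OF k(1) w] negligible_empty]) auto
  ultimately show ?thesis unfolding solves_iff[OF Q f] by auto
qed

lemma solves_imp_solution:
  assumes Q: "L2_on Q" and f: "L2_on f" and k: "k \<noteq> 0" "(wave k True pi)\<^sup>2 \<noteq> 1"
    and y: "solves Q v0 b (k\<^sup>2) f y"
  obtains w where "sol_of k w = y"
    "\<And>i. AC (w i) (\<lambda>x. (\<Sum>j\<in>UNIV. potential_matrix Q v0 k i j x * w j x) + source k f i x)"
    "\<forall>i. w i 0 = (\<Sum>j\<in>UNIV. boundary_matrix b k i j * (w j pi - w j 0))"
proof -
  obtain u where u: "AC y (\<lambda>t. Q t * y t + u t)"
    "AC u (\<lambda>t. f t - Q t * u t - (Q t)\<^sup>2 * y t + (v0 - k\<^sup>2) * y t)" and bc: "bc_holds b y u"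
    using y unfolding solves_iff[OF Q f] by blast
  show ?thesis
  proof (rule that[of "amplitude k y u"])
    show "sol_of k (amplitude k y u) = y" by (simp add: fun_eq_iff sol_of_amplitude)
    show "\<forall>i. amplitude k y u i 0
        = (\<Sum>j\<in>UNIV. boundary_matrix b k i j * (amplitude k y u j pi - amplitude k y u j 0))"
      using bc unfolding bc_iff[OF k refl] .
  qed (rule AC_amplitude[OF k(1) u])
qed

text \<open>Uniformity is the point: \<open>B\<close> precedes \<open>\<epsilon>\<close>, and
  \<open>N\<close> precedes \<open>z\<close> and \<open>f\<close>. It holds because the constants
  \<open>C\<close>, \<open>d\<close>, \<open>K\<close> of the system depend neither on
  \<open>n\<close> nor on the point of the circle.\<close>

lemma resolvent_estimates:
  assumes Q: "L2_on Q"
  obtains B where "B \<ge> 0"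
    "\<And>\<epsilon>. \<epsilon> > 0 \<Longrightarrow> \<exists>N. \<forall>n\<ge>N. \<forall>z f. cmod (z - (of_nat n)\<^sup>2) = real n \<longrightarrow> L2_on f \<longrightarrow>
        (\<exists>y. solves Q v0 b z f y) \<and>
        (\<forall>y x. solves Q v0 b z f y \<longrightarrow> x \<in> {0..pi} \<longrightarrow>
           cmod (y x) \<le> B * L1_norm f \<and>
           cmod (y x - free_sol b (csqrt z) f x) \<le> \<epsilon> / real n * L1_norm f)"
proof -
  obtain c where c: "c > 0"
    "\<And>\<kappa>. 1/3 \<le> cmod \<kappa> \<Longrightarrow> cmod \<kappa> \<le> 2/3 \<Longrightarrow> c \<le> cmod (1 - exp (2 * of_real pi * \<i> * \<kappa>))"
    using exp_gap by blast
  note AI_Q = L2_on_AI[OF Q]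
  have AI_r: "AI (\<lambda>x. v0 - (Q x)\<^sup>2)"
    by (intro set_integral_diff L2_on_AI_square Q AI_continuous continuous_intros)
  define R where "R = exp (2 * pi) * L1_norm (\<lambda>x. v0 - (Q x)\<^sup>2)"
  define C where "C = exp (2 * pi) * (L1_norm Q + L1_norm (\<lambda>x. v0 - (Q x)\<^sup>2))"
  define d where "d = (exp pi + 1) ^ 3 / c"
  define K where "K = 1 + 2 * d"
  \<comment> \<open>The constants of \<open>small\<close> and of \<open>solution_approx\<close> for
    two components.\<close>
  define S where "S = 2\<^sup>2 * K * (1 + K) * (1 + 2 * C)"
  define T where "T = K * 2 * ((1 + 2 * C) * (4 * K) + 1)"
  define E where "E = exp (2 * pi)"
  have E: "E = exp pi * exp pi" "E > 0" by (simp_all add: E_def flip: exp_add)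
  have pos: "R \<ge> 0" "C \<ge> 0" "d > 0" using c(1) by (auto simp: R_def C_def d_def add_pos_pos)
  then have Kpos: "K > 0" by (simp add: K_def)
  then have ST: "S > 0" "T > 0" using pos by (auto simp: S_def T_def add_pos_nonneg)
  show ?thesis
  proof (rule that[of "4 * K * E"])
    show "0 \<le> 4 * K * E" using Kpos E by simp
    fix \<epsilon> :: real assume \<epsilon>: "\<epsilon> > 0"
    \<comment> \<open>The first entry meets \<open>small\<close>. For the second, two factors
      \<open>exp pi\<close>, from \<open>sol_of\<close> and from the source, and
      \<open>1 / cmod k \<le> 2 / n\<close> multiply \<open>T * \<delta>\<close> to
      \<open>2 * E * T * \<delta> / n\<close>.\<close>
    define \<delta> where "\<delta> = min (1 / (2 * S)) (\<epsilon> / (2 * E * T))"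
    have \<delta>: "\<delta> > 0" "\<delta> * S \<le> 1/2" "2 * E * T * \<delta> \<le> \<epsilon>"
      using \<epsilon> ST E(2) by (auto simp: \<delta>_def min_def field_simps)
    obtain RL where RL: "\<And>c x. RL \<le> cmod c \<Longrightarrow> \<bar>Re c\<bar> \<le> 2 \<Longrightarrow> x \<in> {0..pi} \<Longrightarrow>
        cmod (integral {0..x} (\<lambda>t. Q t * exp (c * of_real t))) \<le> \<delta> / 2"
      using riemann_lebesgue[OF AI_Q, of "\<delta> / 2" 2] \<delta>(1) by auto
    \<comment> \<open>In turn: the oscillating part is at most \<open>\<delta> / 2\<close>, the
      \<open>1/k\<close> part is at most \<open>\<delta> / 2\<close>, and \<open>csqrt_near\<close>
      applies.\<close>
    obtain N :: nat where N: "RL \<le> real N" "2 * R / \<delta> \<le> real N" "2 \<le> N"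
    proof -
      obtain N :: nat where "max RL (max (2 * R / \<delta>) 2) \<le> real N" using real_arch_simple by blast
      then show ?thesis by (intro that[of N]) auto
    qed
    show "\<exists>N. \<forall>n\<ge>N. \<forall>z f. cmod (z - (of_nat n)\<^sup>2) = real n \<longrightarrow> L2_on f \<longrightarrow>
        (\<exists>y. solves Q v0 b z f y) \<and>
        (\<forall>y x. solves Q v0 b z f y \<longrightarrow> x \<in> {0..pi} \<longrightarrow>
           cmod (y x) \<le> 4 * K * E * L1_norm f \<and>
           cmod (y x - free_sol b (csqrt z) f x) \<le> \<epsilon> / real n * L1_norm f)"
    proof (intro exI[of _ N] allI impI conjI)
      fix n z f
      assume n: "N \<le> n" and z: "cmod (z - (of_nat n)\<^sup>2) = real n" and f: "L2_on f"
      have n2: "n \<ge> 2" using n N(3) by simp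
      define k where "k = csqrt z"
      obtain \<kappa> where \<kappa>: "k = of_nat n + \<kappa>" "1/3 \<le> cmod \<kappa>" "cmod \<kappa> \<le> 2/3"
        using csqrt_near[OF n2 z] k_def by metis
      have kz: "k\<^sup>2 = z" by (simp add: k_def)
      have Im: "\<bar>Im k\<bar> \<le> 1" using abs_Im_le_cmod[of \<kappa>] \<kappa> by simp
      have kn: "real n \<le> 2 * cmod k"
        unfolding \<kappa>(1) using norm_triangle_ineq2[of "of_nat n" "- \<kappa>"] \<kappa>(3) n2 norm_of_nat[of n, where 'a=complex]
        by simp
      have k1: "1 \<le> cmod k" using kn n2 by linarith
      have k0: "k \<noteq> 0" using k1 by auto
      have gap: "c \<le> cmod (1 - (wave k True pi)\<^sup>2)"
        unfolding \<kappa>(1) wave_pi_shift by (rule c(2)[OF \<kappa>(2,3)])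
      then have ne1: "(wave k True pi)\<^sup>2 \<noteq> 1" using c(1) by auto
      note pm = potential_matrix_bounds[OF AI_Q AI_r Im k1]
      have osc: "cmod (integral {0..x} (potential_matrix Q v0 k i j)) \<le> \<delta>" if "x \<in> {0..pi}" for x i j
      proof -
        have "cmod (integral {0..x} (\<lambda>t. Q t * exp (2 * sg i * \<i> * k * of_real t))) \<le> \<delta> / 2"
        proof (rule RL[OF _ _ that])
          show "RL \<le> cmod (2 * sg i * \<i> * k)" using N(1) n kn by (simp add: norm_mult)
          show "\<bar>Re (2 * sg i * \<i> * k)\<bar> \<le> 2" using Im by (cases i) auto
        qed
        from pm(3)[OF that this] \<delta>(1)
        have "cmod (integral {0..x} (potential_matrix Q v0 k i j)) \<le> \<delta> / 2 + R / (2 * cmod k)"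
          by (simp add: R_def)
        also have "R / (2 * cmod k) \<le> \<delta> / 2"
        proof -
          have "2 * R / \<delta> \<le> 2 * cmod k" using N(2) n kn by linarith
          then have "R \<le> \<delta> * cmod k" using \<delta>(1) by (simp add: field_simps)
          moreover have "cmod k > 0" using k1 by linarith
          ultimately show ?thesis by (simp add: field_simps)
        qed
        finally show ?thesis by simp
      qed
      interpret oscillating_system "potential_matrix Q v0 k" "boundary_matrix b k" C d \<delta> 2 K
      proof
        show "cmod (boundary_matrix b k i j) \<le> d" for i j
          unfolding d_def by (rule boundary_matrix_bound[OF Im c(1) gap])
        show "\<delta> * (2\<^sup>2 * K * (1 + K) * (1 + 2 * C)) \<le> 1 / 2" using \<delta>(2) by (simp add: S_def)
      qed (use pm(1,2) osc in \<open>auto simp: C_def K_def\<close>)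
      note AI_f = L2_on_AI[OF f]
      note F = source_bound[OF AI_f Im]
      define \<phi> where "\<phi> = exp pi / cmod k * L1_norm f"
      have F2: "L1_norm (source k f i) \<le> \<phi>" for i using F(2) by (simp add: \<phi>_def)
      have sys: "solution (source k f) w \<longleftrightarrow>
          (\<forall>i. AC (w i) (\<lambda>x. (\<Sum>j\<in>UNIV. potential_matrix Q v0 k i j x * w j x) + source k f i x)) \<and>
          (\<forall>i. w i 0 = (\<Sum>j\<in>UNIV. boundary_matrix b k i j * (w j pi - w j 0)))" for w
        unfolding solution_def lin_def by (rule refl)
      show "\<exists>y. solves Q v0 b z f y"
        using solution_exists[of "source k f", OF F(1)] solution_imp_solves[OF Q f k0 ne1]
        unfolding sys kz by blast
      fix y x assume y: "solves Q v0 b z f y" and x: "x \<in> {0..pi}"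
      obtain w where w: "sol_of k w = y" "solution (source k f) w"
        using solves_imp_solution[OF Q f k0 ne1 y[folded kz]] unfolding sys by blast
      have "cmod (y x) \<le> exp pi * (4 * K * \<phi>)"
        using sol_of_diff_bound[OF Im x, of w "\<lambda>_ _. 0"] solution_bound[OF w(2) F(1) F2 x]
        by (simp add: w(1) sol_of_def[of k "\<lambda>_ _. 0"])
      also have "\<dots> = 4 * K * E * (L1_norm f / cmod k)" by (simp add: \<phi>_def E(1))
      \<comment> \<open>The decay in \<open>k\<close> may be dropped here: this bound only serves
        uniqueness and continuity in \<open>z\<close>.\<close>
      also have "\<dots> \<le> 4 * K * E * (L1_norm f / 1)"
        using k1 Kpos E(2) by (intro mult_left_mono divide_left_mono) auto
      finally show "cmod (y x) \<le> 4 * K * E * L1_norm f" by simp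
      have "cmod (y x - free_sol b k f x) \<le> exp pi * (\<delta> * T * \<phi>)"
        unfolding free_sol_def w(1)[symmetric] T_def
        by (intro sol_of_diff_bound[OF Im x] solution_approx[OF w(2) F(1) F2 x])
      also have "\<dots> = E * T * \<delta> * (L1_norm f / cmod k)" by (simp add: \<phi>_def E(1))
      also have "\<dots> \<le> E * T * \<delta> * (L1_norm f / (real n / 2))"
        using kn k1 n2 ST(2) E(2) \<delta>(1) by (intro mult_left_mono divide_left_mono mult_pos_pos) auto
      also have "\<dots> = 2 * E * T * \<delta> * (L1_norm f / real n)" by simp
      also have "\<dots> \<le> \<epsilon> * (L1_norm f / real n)"
        by (intro mult_right_mono \<delta>(3)) simp
      finally show "cmod (y x - free_sol b (csqrt z) f x) \<le> \<epsilon> / real n * L1_norm f"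
        by (simp add: k_def)
    qed
  qed
qed

text \<open>The resolvent identity: \<open>(z - L)(y - y') = f - (z - L) y' = (z' - z) y'\<close>.
  For \<open>z' = z\<close> the right-hand side is 0, which gives uniqueness; otherwise it measures
  the variation in \<open>z\<close>.\<close>

lemma solves_diff:
  assumes Q: "L2_on Q" and f: "L2_on f" 
    and y: "solves Q v0 b z f y" and y': "solves Q v0 b z' f y'"
  shows "solves Q v0 b z (\<lambda>x. (z' - z) * y' x) (\<lambda>x. y x - y' x)"
    and "L2_on (\<lambda>x. (z' - z) * y' x)"
proof -
  obtain u where u: "AC y (\<lambda>t. Q t * y t + u t)"
    "AC u (\<lambda>t. f t - Q t * u t - (Q t)\<^sup>2 * y t + (v0 - z) * y t)" "bc_holds b y u"
    and out: "\<forall>x. x \<notin> {0..pi} \<longrightarrow> y x = 0"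
    using y unfolding solves_iff[OF Q f] by blast
  obtain u' where u': "AC y' (\<lambda>t. Q t * y' t + u' t)"
    "AC u' (\<lambda>t. f t - Q t * u' t - (Q t)\<^sup>2 * y' t + (v0 - z') * y' t)" "bc_holds b y' u'"
    and out': "\<forall>x. x \<notin> {0..pi} \<longrightarrow> y' x = 0"
    using y' unfolding solves_iff[OF Q f] by blast
  show L2: "L2_on (\<lambda>x. (z' - z) * y' x)"
    by (intro L2_on_continuous continuous_intros AC_continuous[OF u'(1)])
  have "AC (\<lambda>x. y x - y' x) (\<lambda>t. Q t * (y t - y' t) + (u t - u' t))"
    by (rule AC_cong[OF AC_diff[OF u(1) u'(1)] negligible_empty]) (auto simp: algebra_simps)
  moreover have "AC (\<lambda>x. u x - u' x) (\<lambda>t. (z' - z) * y' t - Q t * (u t - u' t)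
      - (Q t)\<^sup>2 * (y t - y' t) + (v0 - z) * (y t - y' t))"
    by (rule AC_cong[OF AC_diff[OF u(2) u'(2)] negligible_empty]) (auto simp: algebra_simps)
  moreover have "bc_holds b (\<lambda>x. y x - y' x) (\<lambda>x. u x - u' x)"
    using u(3) u'(3) by (cases b) auto
  ultimately show "solves Q v0 b z (\<lambda>x. (z' - z) * y' x) (\<lambda>x. y x - y' x)"
    unfolding solves_iff[OF Q L2] using out out' by (intro conjI exI[of _ "\<lambda>x. u x - u' x"]) auto
qed

text \<open>Phrased through \<open>solves\<close>, so that it is meaningful before
  \<open>resolvent\<close> is known to be well defined.\<close>

definition resolvent_bound :: "(real \<Rightarrow> complex) \<Rightarrow> complex \<Rightarrow> bc \<Rightarrow> complex \<Rightarrow> real \<Rightarrow> bool" where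
  "resolvent_bound Q v0 b z B \<longleftrightarrow> (\<forall>g y. L2_on g \<longrightarrow> solves Q v0 b z g y \<longrightarrow>
     (\<forall>x\<in>{0..pi}. cmod (y x) \<le> B * L1_norm g))"

lemma resolvent_boundD:
  "resolvent_bound Q v0 b z B \<Longrightarrow> L2_on g \<Longrightarrow> solves Q v0 b z g y \<Longrightarrow> x \<in> {0..pi} \<Longrightarrow>
    cmod (y x) \<le> B * L1_norm g"
  unfolding resolvent_bound_def by blast

text \<open>Two solutions differ by one with zero right-hand side, which the bound forces to vanish
  on \<open>[0,pi]\<close>; outside, both are 0 by the convention in \<open>in_dom\<close>. Hence
  the description in \<open>resolvent\<close> denotes.\<close>

lemma resolvent_solves:
  assumes Q: "L2_on Q" and f: "L2_on f" and ex: "\<exists>y. solves Q v0 b z f y"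
    and bound: "resolvent_bound Q v0 b z B"
  shows "solves Q v0 b z f (resolvent Q v0 b z f)"
proof -
  have "y = y'" if "solves Q v0 b z f y" "solves Q v0 b z f y'" for y y'
  proof
    fix x
    show "y x = y' x"
    proof (cases "x \<in> {0..pi}")
      case True
      have "cmod (y x - y' x) \<le> B * L1_norm (\<lambda>x. (z - z) * y' x)"
        by (rule resolvent_boundD[OF bound solves_diff(2,1)[OF Q f that] True])
      then show ?thesis by (simp add: L1_norm_def)
    next
      case False
      then show ?thesis using that unfolding solves_iff[OF Q f] by simp
    qed
  qed
  with ex show ?thesis unfolding resolvent_def by (metis (no_types, lifting) theI')
qed

text \<open>By the resolvent identity \<open>z \<mapsto> (z - L)\<^sup>-\<^sup>1 f\<close> is Lipschitz on the circle.\<close>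

lemma resolvent_contour_integrable:
  assumes Q: "L2_on Q" and f: "L2_on f" and B: "B \<ge> 0" and x: "x \<in> {0..pi}" and r: "0 \<le> r"
    and ex: "\<And>z. cmod (z - a) = r \<Longrightarrow> \<exists>y. solves Q v0 b z f y"
    and bound: "\<And>z. cmod (z - a) = r \<Longrightarrow> resolvent_bound Q v0 b z B"
  shows "(\<lambda>z. resolvent Q v0 b z f x) contour_integrable_on circlepath a r"
proof (rule contour_integrable_continuous_circlepath)
  define Y where "Y z = resolvent Q v0 b z f" for z
  have Y: "solves Q v0 b z f (Y z)" if "cmod (z - a) = r" for z
    unfolding Y_def by (rule resolvent_solves[OF Q f ex[OF that] bound[OF that]])
  have "(pi * B\<^sup>2 * L1_norm f)-lipschitz_on (sphere a r) (\<lambda>z. Y z x)"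
  proof (rule lipschitz_onI)
    fix z w assume "z \<in> sphere a r" "w \<in> sphere a r"
    then have zw: "cmod (z - a) = r" "cmod (w - a) = r" by (auto simp: dist_norm norm_minus_commute)
    note d = solves_diff[OF Q f Y[OF zw(1)] Y[OF zw(2)]]
    \<comment> \<open>One application of the bound controls \<open>Y w\<close> pointwise,
      integration over \<open>[0,pi]\<close> costs \<open>pi\<close>, and a second application
      follows: hence the Lipschitz constant with \<open>pi * B\<^sup>2\<close>.\<close>
    have "L1_norm (\<lambda>x. (w - z) * Y w x) \<le> integral {0..pi} (\<lambda>x. cmod (w - z) * (B * L1_norm f))"
      unfolding L1_norm_def
      by (intro integral_le AI_norm_integrable L2_on_AI d(2) integrable_const_ivl)
         (use resolvent_boundD[OF bound[OF zw(2)] f Y[OF zw(2)]] in \<open>auto simp: norm_mult L1_norm_def intro!: mult_left_mono\<close>)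
    also have "\<dots> = pi * (cmod (w - z) * (B * L1_norm f))" by simp
    finally have "B * L1_norm (\<lambda>x. (w - z) * Y w x) \<le> B * (pi * (cmod (w - z) * (B * L1_norm f)))"
      by (rule mult_left_mono[OF _ B])
    with resolvent_boundD[OF bound[OF zw(1)] d(2,1) x] have "cmod (Y z x - Y w x) \<le> B * (pi * (cmod (w - z) * (B * L1_norm f)))"
      by linarith
    then show "dist (Y z x) (Y w x) \<le> pi * B\<^sup>2 * L1_norm f * dist z w"
      by (simp add: dist_norm norm_minus_commute power2_eq_square mult_ac)
  qed (use B in simp)
  then show "continuous_on (path_image (circlepath a r)) (\<lambda>z. resolvent Q v0 b z f x)"
    using r unfolding Y_def by (simp add: lipschitz_on_continuous_on)
qed

theorem theorem1:
  fixes Q :: "real \<Rightarrow> complex" and v0 :: complex and b :: bc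
  assumes "\<forall>x. Q (x + pi) = Q x"
    and "L2_on Q"
    and "integral {0..pi} Q = 0"
  shows "\<forall>\<epsilon>>0. \<exists>N. \<forall>n\<ge>N. relevant_index b n \<longrightarrow>
           (\<forall>f. L2_on f \<longrightarrow> (\<forall>x\<in>{0..pi}.
              cmod (riesz_proj Q v0 b n f x - riesz_proj (\<lambda>_. 0) 0 b n f x) \<le> \<epsilon> * L1_norm f))"
proof (intro allI impI)
  fix \<epsilon> :: real assume \<epsilon>: "\<epsilon> > 0"
  note Q = \<open>L2_on Q\<close>
  \<comment> \<open>The free operator is the case \<open>Q = 0\<close>, \<open>v0 = 0\<close>, so
    the same estimate serves both operators with the same \<open>free_sol\<close>; each takes half
    of \<open>\<epsilon>\<close>.\<close>
  have Q0: "L2_on (\<lambda>_. 0)" by (intro L2_on_continuous continuous_intros)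
  obtain B N where B: "B \<ge> 0" and N: "\<And>n z f. n \<ge> N \<Longrightarrow> cmod (z - (of_nat n)\<^sup>2) = real n \<Longrightarrow> L2_on f \<Longrightarrow>
      (\<exists>y. solves Q v0 b z f y) \<and>
      (\<forall>y x. solves Q v0 b z f y \<longrightarrow> x \<in> {0..pi} \<longrightarrow> cmod (y x) \<le> B * L1_norm f \<and>
         cmod (y x - free_sol b (csqrt z) f x) \<le> \<epsilon> / 2 / real n * L1_norm f)"
    using resolvent_estimates[OF Q, of v0 b] \<epsilon> half_gt_zero by metis
  obtain B0 N0 where B0: "B0 \<ge> 0" and N0: "\<And>n z f. n \<ge> N0 \<Longrightarrow> cmod (z - (of_nat n)\<^sup>2) = real n \<Longrightarrow> L2_on f \<Longrightarrow>
      (\<exists>y. solves (\<lambda>_. 0) 0 b z f y) \<and>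
      (\<forall>y x. solves (\<lambda>_. 0) 0 b z f y \<longrightarrow> x \<in> {0..pi} \<longrightarrow> cmod (y x) \<le> B0 * L1_norm f \<and>
         cmod (y x - free_sol b (csqrt z) f x) \<le> \<epsilon> / 2 / real n * L1_norm f)"
    using resolvent_estimates[OF Q0, of 0 b] \<epsilon> half_gt_zero by metis
  show "\<exists>N. \<forall>n\<ge>N. relevant_index b n \<longrightarrow>
           (\<forall>f. L2_on f \<longrightarrow> (\<forall>x\<in>{0..pi}.
              cmod (riesz_proj Q v0 b n f x - riesz_proj (\<lambda>_. 0) 0 b n f x) \<le> \<epsilon> * L1_norm f))"
  \<comment> \<open>The 1 keeps \<open>n\<close> positive, so that the factor \<open>1/n\<close>
    cancels against the length of the circle.\<close>
  proof (intro exI[of _ "max 1 (max N N0)"] allI impI ballI)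
    fix n f x
    assume n: "max 1 (max N N0) \<le> n" and f: "L2_on f" and x: "x \<in> {0..pi}"
    then have n': "n \<ge> N" "n \<ge> N0" "n > 0" by auto
    define a :: complex where "a = (of_nat n)\<^sup>2"
    define Y where "Y z = resolvent Q v0 b z f x" for z
    define Y0 where "Y0 z = resolvent (\<lambda>_. 0) 0 b z f x" for z
    note P = N[OF n'(1), folded a_def] and P0 = N0[OF n'(2), folded a_def]
    have bd: "resolvent_bound Q v0 b z B" if "cmod (z - a) = real n" for z
      unfolding resolvent_bound_def using P[OF that] by blast
    have bd0: "resolvent_bound (\<lambda>_. 0) 0 b z B0" if "cmod (z - a) = real n" for z
      unfolding resolvent_bound_def using P0[OF that] by blast
    have ex: "\<exists>y. solves Q v0 b z f y" and ex0: "\<exists>y. solves (\<lambda>_. 0) 0 b z f y"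
      if "cmod (z - a) = real n" for z using P[OF that f] P0[OF that f] by blast+
    have int: "Y contour_integrable_on circlepath a (real n)"
      unfolding Y_def by (rule resolvent_contour_integrable[OF Q f B x _ ex bd]) auto
    have int0: "Y0 contour_integrable_on circlepath a (real n)"
      unfolding Y0_def by (rule resolvent_contour_integrable[OF Q0 f B0 x _ ex0 bd0]) auto
    have diff: "cmod (Y z - Y0 z) \<le> \<epsilon> / real n * L1_norm f" if z: "cmod (z - a) = real n" for z
    proof -
      have "solves Q v0 b z f (resolvent Q v0 b z f)"
        by (rule resolvent_solves[OF Q f ex[OF z] bd[OF z]])
      then have 1: "cmod (Y z - free_sol b (csqrt z) f x) \<le> \<epsilon> / 2 / real n * L1_norm f"
        using P[OF z f] x unfolding Y_def by blast
      have "solves (\<lambda>_. 0) 0 b z f (resolvent (\<lambda>_. 0) 0 b z f)"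
        by (rule resolvent_solves[OF Q0 f ex0[OF z] bd0[OF z]])
      then have 2: "cmod (Y0 z - free_sol b (csqrt z) f x) \<le> \<epsilon> / 2 / real n * L1_norm f"
        using P0[OF z f] x unfolding Y0_def by blast
      have "cmod (Y z - Y0 z) \<le> \<epsilon> / 2 / real n * L1_norm f + \<epsilon> / 2 / real n * L1_norm f"
        using norm_triangle_ineq4[of "Y z - free_sol b (csqrt z) f x" "Y0 z - free_sol b (csqrt z) f x"] 1 2
        by simp
      then show ?thesis by (simp add: field_simps)
    qed
    have "cmod (contour_integral (circlepath a (real n)) Y - contour_integral (circlepath a (real n)) Y0)
      \<le> \<epsilon> / real n * L1_norm f * (2 * pi * real n)"
    proof (rule has_contour_integral_bound_circlepath)
      show "((\<lambda>z. Y z - Y0 z) has_contour_integral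
          contour_integral (circlepath a (real n)) Y - contour_integral (circlepath a (real n)) Y0) (circlepath a (real n))"
        by (intro has_contour_integral_diff has_contour_integral_integral int int0)
    qed (use n' \<epsilon> diff in auto)
    also have "\<dots> = \<epsilon> * L1_norm f * (2 * pi)" using n' by simp
    finally have "cmod (contour_integral (circlepath a (real n)) Y - contour_integral (circlepath a (real n)) Y0) / (2 * pi)
      \<le> \<epsilon> * L1_norm f" by (simp add: field_simps)
    then show "cmod (riesz_proj Q v0 b n f x - riesz_proj (\<lambda>_. 0) 0 b n f x) \<le> \<epsilon> * L1_norm f"
      unfolding riesz_proj_def a_def[symmetric] Y_def[symmetric] Y0_def[symmetric] diff_divide_distrib[symmetric]
      by (simp add: norm_divide norm_mult)
  qed
qed

end
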